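(* Let $\widehat{\mathcal S}$ be a Neumann subgroup of $\widehat{\mathcal M}=PGL(2,\mathbb Z)$, and let $\widehat p$, $A$, $B$, $V$, $C=AB$, $\iota:\mathbb Z\to\mathbb Z$, $\delta:\mathbb Z\to\{-1,1\}$ and $\Sigma_n\in\widehat{\mathcal S}$ ($n\in\mathbb Z$) be as defined in the context. Then: 1. $\iota$ is an involution on $\mathbb Z$ (i.e. $\iota\circ\iota=\mathrm{id}$) and $\delta_{\iota(n)}=\delta_n$ for all $n\in\mathbb Z$; 2. if $\widehat pC^kV^{\epsilon_k}$, $\widehat pC^lV^{\epsilon_l}$ and $\widehat pC^mV^{\epsilon_m}$ (with $\epsilon_k,\epsilon_l,\epsilon_m\in\{0,1\}$) are three vertices in the same $B$-cycle, then $\delta_k\delta_l\delta_m=1$ (equivalently, $\delta_{\pi(l)}\delta_{\pi(m)}-\delta_{\pi(k)}=0$ for every permutation $\pi$ of the three indices $k,l,m$); 3. $\iota(\iota(n)+\delta_n)=\iota(n-1)-\delta_{n-1}$ for every $n\in\mathbb Z$; 4. $$\big\langle \Sigma_n\ \big|\ \Sigma_n\Sigma_{\iota(n)+\delta_n}\Sigma_{\iota(n-1)}=1,\ n\in\mathbb Z\big\rangle$$ is a presentation of $\widehat{\mathcal S}$.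
   Context: In $\widehat{\mathcal M}=PGL(2,\mathbb Z)$ put $A=\omega=\pm\begin{pmatrix}0&-1\\1&0\end{pmatrix}$, $B=\varphi=\pm\begin{pmatrix}0&-1\\1&1\end{pmatrix}$, $V=\nu=\pm\begin{pmatrix}-1&0\\0&1\end{pmatrix}$, $C=AB=\tau=\pm\begin{pmatrix}1&1\\0&1\end{pmatrix}$. Then $\widehat{\mathcal M}=\langle A,B,V\mid A^2=B^3=V^2=(AV)^2=(ABV)^2=1\rangle$. Let $\widehat{\mathcal T}=\{\tau^n\nu^\epsilon:n\in\mathbb Z,\ \epsilon\in\{0,1\}\}$. A Neumann subgroup of $\widehat{\mathcal M}$ is a subgroup $\widehat{\mathcal S}$ with $\widehat{\mathcal S}\,\widehat{\mathcal T}=\widehat{\mathcal M}$ and $\widehat{\mathcal S}\cap\widehat{\mathcal T}=1$. $\widehat{\mathcal M}$ acts by right multiplication on the set $\Omega$ of right cosets of $\widehat{\mathcal S}$; let $\widehat p=\widehat{\mathcal S}\in\Omega$ be the trivial coset, whose stabilizer is $\widehat{\mathcal S}$. Every element of $\Omega$ (called a vertex) is uniquely of the form $\widehat pC^nV^\epsilon$, $n\in\mathbb Z$, $\epsilon\in\{0,1\}$. A $B$-cycle is an orbit of size three of $B$ on $\Omega$. The maps $\iota$ and $\delta$ are determined by $$\widehat pC^nA=\widehat pC^{\iota(n)}V^{\frac{1-\delta_n}{2}},\qquad n\in\mathbb Z,$$ and $$\Sigma_n=C^nAV^{\frac{1-\delta_n}{2}}C^{-\iota(n)}\in\widehat{\mathcal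 S},\qquad n\in\mathbb Z.$$
   Formalization: In part 4 the relators Σ_nΣ_{ι(n)} = 1 (n ∈ ℤ) are added to the displayed ones; without them the claim fails for every Neumann subgroup, since sending all Σ_n to a generator of Z/3 respects the displayed relators but not Σ_nΣ_{ι(n)} = 1, which holds in the subgroup. *)

theory Defs
  imports "HOL-Analysis.Analysis" "HOL-Algebra.Coset"
begin

section \<open>The group PGL(2,Z)\<close>

definition GL2Z :: "(int^2^2) monoid" where
  "GL2Z = \<lparr>carrier = {M. invertible M}, mult = (**), one = mat 1\<rparr>"

definition PGL2Z :: "(int^2^2) set monoid" where
  "PGL2Z = GL2Z Mod {mat 1, mat (-1)}"

text \<open>The class of a matrix up to sign, as an element of the quotient group.\<close>

definition pm :: "int^2^2 \<Rightarrow> (int^2^2) set" where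
  "pm M = {mat 1, mat (-1)} #>\<^bsub>GL2Z\<^esub> M"

definition mA :: "(int^2^2) set" where
  "mA = pm (vector [vector [0, -1], vector [1, 0]])"

definition mB :: "(int^2^2) set" where
  "mB = pm (vector [vector [0, -1], vector [1, 1]])"

definition mV :: "(int^2^2) set" where
  "mV = pm (vector [vector [-1, 0], vector [0, 1]])"

definition mC :: "(int^2^2) set" where
  "mC = mA \<otimes>\<^bsub>PGL2Z\<^esub> mB"

definition That :: "(int^2^2) set set" where
  "That = {mC [^]\<^bsub>PGL2Z\<^esub> n \<otimes>\<^bsub>PGL2Z\<^esub> mV [^]\<^bsub>PGL2Z\<^esub> \<epsilon> | (n::int) (\<epsilon>::int). \<epsilon> \<in> {0, 1}}"

definition neumann_subgroup :: "(int^2^2) set set \<Rightarrow> bool" where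
  "neumann_subgroup S \<longleftrightarrow> subgroup S PGL2Z \<and>
     S <#>\<^bsub>PGL2Z\<^esub> That = carrier PGL2Z \<and> S \<inter> That = {\<one>\<^bsub>PGL2Z\<^esub>}"


section \<open>The coset graph of a Neumann subgroup\<close>

text \<open>The group acts on the right cosets of \<open>S\<close> by \<open>P \<mapsto> P #> g\<close>; the base
  point is the coset \<open>S\<close> itself.\<close>

definition vertex :: "(int^2^2) set set \<Rightarrow> int \<Rightarrow> int \<Rightarrow> (int^2^2) set set" where
  "vertex S n \<epsilon> = S #>\<^bsub>PGL2Z\<^esub> (mC [^]\<^bsub>PGL2Z\<^esub> n \<otimes>\<^bsub>PGL2Z\<^esub> mV [^]\<^bsub>PGL2Z\<^esub> \<epsilon>)"

definition B_cycle :: "(int^2^2) set set \<Rightarrow> (int^2^2) set set set \<Rightarrow> bool" where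
  "B_cycle S K \<longleftrightarrow>
     (\<exists>P \<in> rcosets\<^bsub>PGL2Z\<^esub> S. K = {P #>\<^bsub>PGL2Z\<^esub> (mB [^]\<^bsub>PGL2Z\<^esub> i) | (i::int). True}) \<and> card K = 3"

definition iota_delta :: "(int^2^2) set set \<Rightarrow> int \<Rightarrow> int \<times> int" where
  "iota_delta S n = (THE (k, d). d \<in> {-1, 1} \<and>
     vertex S n 0 #>\<^bsub>PGL2Z\<^esub> mA = vertex S k ((1 - d) div 2))"

definition iota :: "(int^2^2) set set \<Rightarrow> int \<Rightarrow> int" where
  "iota S n = fst (iota_delta S n)"

definition delta :: "(int^2^2) set set \<Rightarrow> int \<Rightarrow> int" where
  "delta S n = snd (iota_delta S n)"

text \<open>The elements with indices \<open>n\<close> and \<open>iota S n\<close> are mutually inverse, by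
  \<open>A\<^sup>2 = (AV)\<^sup>2 = 1\<close>. The relators of length three of the presentation do not imply this
  (they also hold when every symbol is sent to a generator of the cyclic group of order
  three), so a presentation on symbols indexed by all integers needs it as a relator.\<close>

definition Sigma_gen :: "(int^2^2) set set \<Rightarrow> int \<Rightarrow> (int^2^2) set" where
  "Sigma_gen S n =
     mC [^]\<^bsub>PGL2Z\<^esub> n \<otimes>\<^bsub>PGL2Z\<^esub> mA \<otimes>\<^bsub>PGL2Z\<^esub> mV [^]\<^bsub>PGL2Z\<^esub> ((1 - delta S n) div 2)
       \<otimes>\<^bsub>PGL2Z\<^esub> mC [^]\<^bsub>PGL2Z\<^esub> (- iota S n)"


section \<open>Group presentations\<close>

text \<open>A letter \<open>(i, True)\<close> is the generator with index \<open>i\<close>, and \<open>(i, False)\<close> is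
  its formal inverse.\<close>

type_synonym 'i word = "('i \<times> bool) list"

inductive free_eq :: "'i word \<Rightarrow> 'i word \<Rightarrow> bool" where
  free_eq_refl: "free_eq u u"
| free_eq_sym: "free_eq u v \<Longrightarrow> free_eq v u"
| free_eq_trans: "free_eq u v \<Longrightarrow> free_eq v w \<Longrightarrow> free_eq u w"
| free_eq_cancel: "free_eq (u @ [(i, b), (i, \<not> b)] @ v) (u @ v)"

definition free_class :: "'i word \<Rightarrow> 'i word set" where
  "free_class u = {v. free_eq u v}"

definition free_group :: "'i word set monoid" where
  "free_group = \<lparr>carrier = range free_class,
     mult = (\<lambda>P Q. \<Union>x\<in>P. \<Union>y\<in>Q. free_class (x @ y)),
     one = free_class []\<rparr>"

definition normal_closure :: "('a, 'b) monoid_scheme \<Rightarrow> 'a set \<Rightarrow> 'a set" where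
  "normal_closure G R = \<Inter>{N. N \<lhd> G \<and> R \<subseteq> N}"

text \<open>\<open>G\<close> is presented by the generators \<open>s i\<close> (\<open>i\<close> ranging over the whole index type)
  and the relators \<open>R\<close>: the assignment \<open>i \<mapsto> s i\<close> induces an isomorphism onto \<open>G\<close> from
  the free group on the symbols \<open>i\<close> modulo the normal closure of \<open>R\<close>. Distinct
  indices are distinct symbols, even if \<open>s\<close> is not injective.\<close>

definition is_presentation ::
    "('a, 'b) monoid_scheme \<Rightarrow> ('i \<Rightarrow> 'a) \<Rightarrow> 'i word set \<Rightarrow> bool" where
  "is_presentation G s R \<longleftrightarrow>
     (let N = normal_closure free_group (free_class ` R)
      in \<exists>h \<in> iso (free_group Mod N) G. \<forall>i. h (N #>\<^bsub>free_group\<^esub> free_class [(i, True)]) = s i)"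


section \<open>Basic facts\<close>

lemma free_eq_append:
  assumes "free_eq u u'" "free_eq v v'"
  shows "free_eq (u @ v) (u' @ v')"
proof -
  have l: "free_eq (a @ x) (a @ y)" if "free_eq x y" for a x y :: "'a word"
    using that
  proof induction
    case (free_eq_cancel u i b v)
    show ?case using free_eq.free_eq_cancel[of "a @ u" i b v] by simp
  next
    case (free_eq_trans u v w)
    then show ?case using free_eq.free_eq_trans by metis
  qed (simp_all add: free_eq.free_eq_refl free_eq.free_eq_sym)
  have r: "free_eq (x @ a) (y @ a)" if "free_eq x y" for a x y :: "'a word"
    using that
  proof induction
    case (free_eq_cancel u i b v)
    show ?case using free_eq.free_eq_cancel[of u i b "v @ a"] by simp
  next
    case (free_eq_trans u v w)
    then show ?case using free_eq.free_eq_trans by metis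
  qed (simp_all add: free_eq.free_eq_refl free_eq.free_eq_sym)
  show ?thesis by (rule free_eq_trans[OF r[OF assms(1)] l[OF assms(2)]])
qed

lemma free_class_eq_iff: "free_class u = free_class v \<longleftrightarrow> free_eq u v"
  unfolding free_class_def using free_eq.intros by blast

lemma free_group_mult:
  "free_class u \<otimes>\<^bsub>free_group\<^esub> free_class v = free_class (u @ v)"
proof -
  have eq: "free_class (x @ y) = free_class (u @ v)" if "x \<in> free_class u" "y \<in> free_class v" for x y
  proof -
    have "free_eq u x" "free_eq v y" using that by (simp_all add: free_class_def)
    then have "free_eq (u @ v) (x @ y)" by (rule free_eq_append)
    then show ?thesis by (metis free_class_eq_iff)
  qed
  have "(\<Union>x\<in>free_class u. \<Union>y\<in>free_class v. free_class (x @ y)) =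
      (\<Union>x\<in>free_class u. \<Union>y\<in>free_class v. free_class (u @ v))"
    using eq by (intro SUP_cong refl) auto
  moreover have "u \<in> free_class u" "v \<in> free_class v"
    by (auto simp: free_class_def free_eq_refl)
  ultimately have "(\<Union>x\<in>free_class u. \<Union>y\<in>free_class v. free_class (x @ y)) = free_class (u @ v)"
    by auto
  then show ?thesis by (simp add: free_group_def)
qed

lemma free_eq_inverse:
  "free_eq (rev (map (\<lambda>(i, b). (i, \<not> b)) u) @ u) []"
proof (induction u)
  case (Cons a u)
  obtain i b where a: "a = (i, b)" by fastforce
  let ?r = "rev (map (\<lambda>(i, b). (i, \<not> b)) u)"
  have "free_eq (?r @ [(i, \<not> b), (i, \<not> \<not> b)] @ u) (?r @ u)"
    by (rule free_eq_cancel)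
  from free_eq_trans[OF this Cons.IH] show ?case by (simp add: a)
qed (simp add: free_eq_refl)

lemma free_group_sel:
  "carrier free_group = range free_class" "\<one>\<^bsub>free_group\<^esub> = free_class []"
  by (simp_all add: free_group_def)

lemma group_free_group: "group free_group"
proof (rule groupI)
  fix x :: "'a word set" assume "x \<in> carrier free_group"
  then obtain u where u: "x = free_class u" by (auto simp: free_group_sel)
  let ?y = "free_class (rev (map (\<lambda>(i, b). (i, \<not> b)) u))"
  have "?y \<otimes>\<^bsub>free_group\<^esub> x = free_class []"
    unfolding u free_group_mult free_class_eq_iff by (rule free_eq_inverse)
  then show "\<exists>y\<in>carrier free_group. y \<otimes>\<^bsub>free_group\<^esub> x = \<one>\<^bsub>free_group\<^esub>"
    by (auto simp: free_group_sel)
qed (auto simp: free_group_sel free_group_mult)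

lemma normal_normal_closure:
  assumes "group G" "R \<subseteq> carrier G"
  shows "normal_closure G R \<lhd> G"
proof -
  interpret group G by fact
  let ?F = "{N. N \<lhd> G \<and> R \<subseteq> N}"
  have "carrier G \<lhd> G"
    unfolding normal_inv_iff by (auto simp: subgroup_self)
  then have ne: "?F \<noteq> {}" using assms(2) by blast
  have "subgroup (\<Inter>?F) G"
    by (rule subgroups_Inter) (use ne normal_imp_subgroup in auto)
  moreover have "x \<otimes>\<^bsub>G\<^esub> h \<otimes>\<^bsub>G\<^esub> inv\<^bsub>G\<^esub> x \<in> \<Inter>?F" if "x \<in> carrier G" "h \<in> \<Inter>?F" for x h
    using that normal_inv_iff by auto
  ultimately show ?thesis
    unfolding normal_closure_def normal_inv_iff by blast
qed

lemma mat_minus_one_mult: "mat (-1) ** M = - M" "M ** mat (-1) = - (M :: int^2^2)"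
  by (auto simp: vec_eq_iff matrix_matrix_mult_def mat_def sum_2 forall_2)

lemma group_GL2Z: "group GL2Z"
proof (rule groupI)
  fix M :: "int^2^2" assume "M \<in> carrier GL2Z"
  then obtain N where "M ** N = mat 1" "N ** M = mat 1"
    by (auto simp: GL2Z_def invertible_def)
  then show "\<exists>N\<in>carrier GL2Z. N \<otimes>\<^bsub>GL2Z\<^esub> M = \<one>\<^bsub>GL2Z\<^esub>"
    by (auto simp: GL2Z_def invertible_def)
next
  fix M N :: "int^2^2" assume "M \<in> carrier GL2Z" "N \<in> carrier GL2Z"
  then obtain M' N' where "M ** M' = mat 1" "M' ** M = mat 1" "N ** N' = mat 1" "N' ** N = mat 1"
    by (auto simp: GL2Z_def invertible_def)
  then have "(M ** N) ** (N' ** M') = mat 1" "(N' ** M') ** (M ** N) = mat 1"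
    by (metis matrix_mul_assoc matrix_mul_rid)+
  then show "M \<otimes>\<^bsub>GL2Z\<^esub> N \<in> carrier GL2Z"
    by (auto simp: GL2Z_def invertible_def)
next
  show "\<one>\<^bsub>GL2Z\<^esub> \<in> carrier GL2Z"
    by (auto simp: GL2Z_def invertible_def intro!: exI[of _ "mat 1"])
qed (auto simp: GL2Z_def matrix_mul_assoc)

lemma normal_center_GL2Z: "{mat 1, mat (-1)} \<lhd> GL2Z"
proof -
  interpret group GL2Z by (rule group_GL2Z)
  have mm: "mat (-1) ** mat (-1) = (mat 1 :: int^2^2)"
    unfolding mat_minus_one_mult by (auto simp: vec_eq_iff mat_def)
  have i: "inv\<^bsub>GL2Z\<^esub> mat (-1) = mat (-1)"
    by (rule inv_equality) (use mm in \<open>auto simp: GL2Z_def invertible_def\<close>)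
  have i1: "inv\<^bsub>GL2Z\<^esub> mat 1 = mat 1"
    using inv_one by (simp add: GL2Z_def)
  have "subgroup {mat 1, mat (-1)} GL2Z"
    by unfold_locales (use mm i i1 in \<open>auto simp: GL2Z_def invertible_def intro: exI[of _ "mat 1"]\<close>)
  moreover have "{mat 1, mat (-1)} #>\<^bsub>GL2Z\<^esub> M = M <#\<^bsub>GL2Z\<^esub> {mat 1, mat (-1)}" for M
    by (auto simp: r_coset_def l_coset_def GL2Z_def mat_minus_one_mult)
  ultimately show ?thesis by (auto intro: normalI)
qed

lemma group_PGL2Z: "group PGL2Z"
  unfolding PGL2Z_def using normal.factorgroup_is_group[OF normal_center_GL2Z] .

lemma pm_eq: "pm M = {M, - M}"
  by (auto simp: pm_def r_coset_def GL2Z_def mat_minus_one_mult)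

lemma pm_in_carrier: "invertible M \<Longrightarrow> pm M \<in> carrier PGL2Z"
  by (auto simp: pm_def PGL2Z_def FactGroup_def RCOSETS_def GL2Z_def)

lemma pm_mult:
  "invertible M \<Longrightarrow> invertible N \<Longrightarrow> pm M \<otimes>\<^bsub>PGL2Z\<^esub> pm N = pm (M ** N)"
  using normal.rcos_sum[OF normal_center_GL2Z, of M N]
  by (simp add: pm_def PGL2Z_def FactGroup_def GL2Z_def)

lemma mat2_eqI:
  fixes M N :: "'a^2^2"
  assumes "M$1$1 = N$1$1" "M$1$2 = N$1$2" "M$2$1 = N$2$1" "M$2$2 = N$2$2"
  shows "M = N"
  using assms by (auto simp: vec_eq_iff forall_2)

lemma mC_eq: "mC = pm (vector [vector [1, 1], vector [0, 1]])"
proof -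
  let ?A = "vector [vector [0, -1], vector [1, 0]] :: int^2^2"
  let ?B = "vector [vector [0, -1], vector [1, 1]] :: int^2^2"
  have "?A ** (- ?A) = mat 1" "(- ?A) ** ?A = mat 1"
    by (rule mat2_eqI; simp add: matrix_matrix_mult_def mat_def sum_2 vector_2)+
  then have A: "invertible ?A" by (auto simp: invertible_def)
  let ?B' = "vector [vector [1, 1], vector [-1, 0]] :: int^2^2"
  have "?B ** ?B' = mat 1" "?B' ** ?B = mat 1"
    by (rule mat2_eqI; simp add: matrix_matrix_mult_def mat_def sum_2 vector_2)+
  then have B: "invertible ?B" by (auto simp: invertible_def)
  have "?A ** ?B = - vector [vector [1, 1], vector [0, 1]]"
    by (rule mat2_eqI; simp add: matrix_matrix_mult_def sum_2 vector_2)
  then show ?thesis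
    using pm_mult[OF A B] by (auto simp: mC_def mA_def mB_def pm_eq)
qed

end

theory Submission
  imports Defs "HOL-Algebra.Bij" "HOL-Algebra.Generated_Groups"
begin

text \<open>The cosets of \<open>S\<close> are indexed by pairs \<open>(n, s)\<close> with \<open>s = \<plusminus>1\<close>, and \<open>B = AC\<close> maps
  \<open>(n, s)\<close> to \<open>(\<iota> n + s \<delta>\<^sub>n, s \<delta>\<^sub>n)\<close>. The first three claims are the relations \<open>A\<^sup>2 = B\<^sup>3 = 1\<close> read
  off this formula. For the presentation, one first shows that PGL(2,Z) is defined by its relations:
  these allow one to write every element as \<open>k w l\<close>, with \<open>k\<close>, \<open>l\<close> in the Klein four-group generated
  by \<open>A\<close>, \<open>V\<close> and \<open>w\<close> a product of nonnegative unipotent matrices, and such a product is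
  trivial only if \<open>w\<close> is empty. Hence an action of PGL(2,Z) may be given on generators. If \<open>Q\<close> is the group
  defined by the proposed presentation, then the action on the cosets of \<open>S\<close> lifts to one on
  \<open>Q \<times> \<int> \<times> {\<plusminus>1}\<close>, and the action of \<open>S\<close> on the fiber over the base point inverts the map from
  \<open>Q\<close> to \<open>S\<close>.\<close>

section \<open>Groups satisfying the relations of PGL(2,Z)\<close>

text \<open>Since \<open>c = a b\<close> with \<open>a\<close> an involution,
  \<open>b = a c\<close>; so \<open>acacac\<close> is the relation \<open>B\<^sup>3 = 1\<close> and
  \<open>cvcv\<close> is \<open>(ABV)\<^sup>2 = 1\<close>.\<close>

locale modular_group = group G for G (structure) +
  fixes a c v
  assumes closed [simp]: "a \<in> carrier G" "c \<in> carrier G" "v \<in> carrier G"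
    and aa: "a \<otimes> a = \<one>"
    and vv: "v \<otimes> v = \<one>"
    and avav: "(a \<otimes> v) \<otimes> (a \<otimes> v) = \<one>"
    and cvcv: "(c \<otimes> v) \<otimes> (c \<otimes> v) = \<one>"
    and acacac: "(a \<otimes> c) \<otimes> (a \<otimes> c) \<otimes> (a \<otimes> c) = \<one>"
begin

section \<open>Commutation and rewriting rules\<close>

lemma inv_a [simp]: "inv a = a" and inv_v [simp]: "inv v = v"
  using aa vv by (auto intro: inv_equality)

lemma aa_left [simp]: "x \<in> carrier G \<Longrightarrow> a \<otimes> (a \<otimes> x) = x"
  and vv_left [simp]: "x \<in> carrier G \<Longrightarrow> v \<otimes> (v \<otimes> x) = x"
  by (simp_all add: m_assoc [symmetric] aa vv)

lemma va: "v \<otimes> a = a \<otimes> v"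
proof -
  have "inv (a \<otimes> v) = a \<otimes> v" using avav by (intro inv_equality) auto
  then show ?thesis by (simp add: inv_mult_group)
qed

lemma va_left: "x \<in> carrier G \<Longrightarrow> v \<otimes> (a \<otimes> x) = a \<otimes> (v \<otimes> x)"
  by (simp add: m_assoc [symmetric] va)

lemma vc: "v \<otimes> c = inv c \<otimes> v"
proof -
  have "inv (c \<otimes> v) = c \<otimes> v" using cvcv by (intro inv_equality) auto
  then have "v \<otimes> inv c = c \<otimes> v" by (simp add: inv_mult_group)
  then have "v \<otimes> (v \<otimes> inv c) \<otimes> v = v \<otimes> (c \<otimes> v) \<otimes> v" by simp
  then show ?thesis by (simp add: m_assoc vv)
qed

lemma inv_c: "inv c = v \<otimes> c \<otimes> v"
  by (simp add: vc m_assoc vv)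

text \<open>In PGL(2,Z) this is the lower unipotent matrix with rows (1, 0) and (1, 1), the
  transpose of \<open>c\<close>.\<close>

definition d where "d = a \<otimes> inv c \<otimes> a"

lemma d_closed [simp]: "d \<in> carrier G"
  by (simp add: d_def)

text \<open>Conjugating \<open>(a c)^3 = 1\<close> by \<open>a\<close> makes \<open>c a c\<close>
  the inverse of \<open>a c a\<close>. With the three identities that follow, this lets a new letter
  \<open>c\<close> be absorbed into a word in \<open>c\<close> and \<open>d\<close>.\<close>

lemma cac: "c \<otimes> (a \<otimes> c) = d"
proof -
  have "inv (a \<otimes> c \<otimes> a) = c \<otimes> a \<otimes> c"
  proof (rule inv_equality)
    have "a \<otimes> ((a \<otimes> c) \<otimes> (a \<otimes> c) \<otimes> (a \<otimes> c)) \<otimes> a = \<one>" using acacac aa by simp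
    then show "c \<otimes> a \<otimes> c \<otimes> (a \<otimes> c \<otimes> a) = \<one>" by (simp add: m_assoc)
  qed auto
  then show ?thesis by (simp add: inv_mult_group d_def m_assoc)
qed

lemma dac: "d \<otimes> (a \<otimes> c) = a"
  by (simp add: d_def m_assoc)

lemma d_inv_c: "d \<otimes> inv c = c \<otimes> a"
  by (simp add: cac [symmetric] m_assoc)

lemma inv_c': "inv c = a \<otimes> (d \<otimes> a)"
  by (simp add: d_def m_assoc aa)

section \<open>Generation and the normal form\<close>

lemma generate_induct [consumes 1, case_names one a c v]:
  assumes "x \<in> generate G {a, c, v}" and one: "P \<one>"
    and step: "\<And>y. y \<in> carrier G \<Longrightarrow> P y \<Longrightarrow> P (y \<otimes> a)"
      "\<And>y. y \<in> carrier G \<Longrightarrow> P y \<Longrightarrow> P (y \<otimes> c)"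
      "\<And>y. y \<in> carrier G \<Longrightarrow> P y \<Longrightarrow> P (y \<otimes> v)"
  shows "P x"
proof -
  have sub: "generate G {a, c, v} \<subseteq> carrier G" by (rule generate_incl) simp
  have "\<forall>y \<in> carrier G. P y \<longrightarrow> P (y \<otimes> x)"
    using assms(1)
  proof induction
    case (inv h)
    \<comment> \<open>Inverses need no step of their own: \<open>a\<close> and \<open>v\<close> are
      involutions and \<open>inv c = v c v\<close>.\<close>
    have "P (y \<otimes> inv c)" if "y \<in> carrier G" "P y" for y
      using that by (simp add: inv_c m_assoc [symmetric] step)
    with inv show ?case by (auto simp: step)
  next
    case (eng h1 h2)
    have h: "h1 \<in> carrier G" "h2 \<in> carrier G" using eng.hyps sub by auto
    show ?case
    proof (intro ballI impI)
      fix y assume "y \<in> carrier G" "P y"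
      then have "P (y \<otimes> h1 \<otimes> h2)" using eng.IH h by simp
      then show "P (y \<otimes> (h1 \<otimes> h2))" using h \<open>y \<in> carrier G\<close> by (simp add: m_assoc)
    qed
  qed (auto simp: step)
  then have "P (\<one> \<otimes> x)" using one by blast
  then show ?thesis using assms(1) sub by auto
qed

text \<open>In PGL(2,Z) these are the matrices with entries in \<open>{-1, 0, 1}\<close> and exactly two
  nonzero entries; conjugation by them permutes \<open>c\<close>, \<open>d\<close> and their inverses.\<close>

definition K where "K = {\<one>, a, v, a \<otimes> v}"

text \<open>The monoid of positive words in \<open>c\<close> and \<open>d\<close>, extended on the
  right so that case analysis exposes the last letter.\<close>

inductive_set W where
  one: "\<one> \<in> W"
| c: "w \<in> W \<Longrightarrow> w \<otimes> c \<in> W"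
| d: "w \<in> W \<Longrightarrow> w \<otimes> d \<in> W"

lemma W_closed [simp]: "w \<in> W \<Longrightarrow> w \<in> carrier G"
  by (induction rule: W.induct) auto

lemma K_closed [simp]: "k \<in> K \<Longrightarrow> k \<in> carrier G"
  by (auto simp: K_def)

lemma K_mult: "k \<in> K \<Longrightarrow> l \<in> K \<Longrightarrow> k \<otimes> l \<in> K"
  by (auto simp: K_def m_assoc va va_left aa vv)

lemma K_inv: "k \<in> K \<Longrightarrow> inv k \<in> K"
  by (auto simp: K_def inv_mult_group va)

text \<open>Right multiplication by \<open>a\<close> or \<open>v\<close> only changes
  \<open>l\<close>. A letter \<open>c\<close> is moved to the left past \<open>l\<close>:
  conjugation by \<open>a v\<close> turns it into \<open>d\<close>, while for \<open>l = a\<close>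
  or \<open>l = v\<close> it is merged with the last letter of \<open>w\<close>.\<close>

lemma normal_form:
  assumes "x \<in> generate G {a, c, v}"
  shows "\<exists>k \<in> K. \<exists>w \<in> W. \<exists>l \<in> K. x = k \<otimes> w \<otimes> l"
  using assms
proof (induction rule: generate_induct)
  case one
  show ?case by (rule bexI[of _ \<one>], rule bexI[of _ \<one>], rule bexI[of _ \<one>]) (auto simp: K_def W.one)
next
  case (a x)
  then obtain k w l where x: "k \<in> K" "w \<in> W" "l \<in> K" "x = k \<otimes> w \<otimes> l" by blast
  moreover have "x \<otimes> a = k \<otimes> w \<otimes> (l \<otimes> a)" using x by (simp add: m_assoc)
  moreover have "l \<otimes> a \<in> K" using x by (intro K_mult) (auto simp: K_def)
  ultimately show ?case by blast
next
  case (v x)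
  then obtain k w l where x: "k \<in> K" "w \<in> W" "l \<in> K" "x = k \<otimes> w \<otimes> l" by blast
  moreover have "x \<otimes> v = k \<otimes> w \<otimes> (l \<otimes> v)" using x by (simp add: m_assoc)
  moreover have "l \<otimes> v \<in> K" using x by (intro K_mult) (auto simp: K_def)
  ultimately show ?case by blast
next
  case (c x)
  then obtain k w l where x: "k \<in> K" "w \<in> W" "l \<in> K" "x = k \<otimes> w \<otimes> l" by blast
  have kk: "a \<in> K" "v \<in> K" "a \<otimes> v \<in> K" "\<one> \<in> K" "k \<otimes> a \<in> K"
    using x K_mult[of k a] by (auto simp: K_def)
  have ww: "c \<in> W" "d \<in> W" "w \<otimes> c \<in> W" "w \<otimes> d \<in> W"
    using W.c[OF W.one] W.d[OF W.one] W.c W.d x by auto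
  consider (1) "l = \<one>" | (a) "l = a" | (v) "l = v" | (av) "l = a \<otimes> v"
    using x unfolding K_def by blast
  then have "\<exists>k' \<in> K. \<exists>w' \<in> W. \<exists>l' \<in> K. k \<otimes> (w \<otimes> (l \<otimes> c)) = k' \<otimes> (w' \<otimes> l')"
  proof cases
    case 1
    then show ?thesis
      using x kk ww by (intro bexI[of _ k] bexI[of _ "w \<otimes> c"] bexI[of _ \<one>]) auto
  next
    case av
    have "a \<otimes> v \<otimes> c = d \<otimes> (a \<otimes> v)" by (simp add: vc m_assoc d_def)
    then show ?thesis
      using x kk ww av
      by (intro bexI[of _ k] bexI[of _ "w \<otimes> d"] bexI[of _ "a \<otimes> v"]) (auto simp: m_assoc)
  next
    case a
    \<comment> \<open>If \<open>w\<close> is empty, \<open>a\<close> joins \<open>k\<close>. A last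
      letter \<open>c\<close> becomes \<open>d\<close> by \<open>c a c = d\<close>, and a last
      letter \<open>d\<close> disappears by \<open>d a c = a\<close>.\<close>
    from x(2) show ?thesis
    proof cases
      case one
      then show ?thesis using a x kk ww
        by (intro bexI[of _ "k \<otimes> a"] bexI[of _ "c"] bexI[of _ \<one>]) (auto simp: m_assoc)
    next
      case (c u)
      have "k \<otimes> (w \<otimes> (l \<otimes> c)) = k \<otimes> ((u \<otimes> d) \<otimes> \<one>)"
        using c a x by (simp add: m_assoc cac)
      then show ?thesis using x kk W.d[OF c(2)] by blast
    next
      case (d u)
      have "k \<otimes> (w \<otimes> (l \<otimes> c)) = k \<otimes> (u \<otimes> a)"
        using d a x by (simp add: m_assoc dac)
      then show ?thesis using x kk d by blast
    qed
  next
    case v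
    \<comment> \<open>Here \<open>v c = inv c v\<close>. If \<open>w\<close> is empty,
      \<open>inv c = a d a\<close> and the first \<open>a\<close> joins \<open>k\<close>; a last
      \<open>c\<close> cancels; a last \<open>d\<close> becomes \<open>c\<close> by
      \<open>d (inv c) = c a\<close>.\<close>
    from x(2) show ?thesis
    proof cases
      case one
      have "k \<otimes> (w \<otimes> (l \<otimes> c)) = (k \<otimes> a) \<otimes> (d \<otimes> (a \<otimes> v))"
        using v one x by (simp add: vc inv_c' m_assoc)
      then show ?thesis using kk ww by blast
    next
      case (c u)
      have "k \<otimes> (w \<otimes> (l \<otimes> c)) = k \<otimes> (u \<otimes> v)"
        using c v x by (simp add: m_assoc vc) (simp add: m_assoc [symmetric])
      then show ?thesis using x kk c by blast
    next
      case (d u)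
      have "d \<otimes> (v \<otimes> c) = c \<otimes> (a \<otimes> v)"
        by (simp add: vc m_assoc [symmetric] d_inv_c)
      then have "k \<otimes> (w \<otimes> (l \<otimes> c)) = k \<otimes> ((u \<otimes> c) \<otimes> (a \<otimes> v))"
        using d v x by (simp add: m_assoc)
      then show ?thesis using x kk W.c[OF d(2)] by blast
    qed
  qed
  moreover have "x \<otimes> c = k \<otimes> (w \<otimes> (l \<otimes> c))" using x by (simp add: m_assoc)
  ultimately show ?case by (metis K_closed W_closed m_assoc)
qed

end

lemma modular_group_DirProd:
  assumes "modular_group G a c v" "modular_group H a' c' v'"
  shows "modular_group (G \<times>\<times> H) (a, a') (c, c') (v, v')"
proof -
  interpret G: modular_group G a c v by fact
  interpret H: modular_group H a' c' v' by fact
  show ?thesis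
    by (intro modular_group.intro modular_group_axioms.intro DirProd_group G.is_group H.is_group)
      (simp_all add: G.aa G.vv G.avav G.cvcv G.acacac H.aa H.vv H.avav H.cvcv H.acacac)
qed

section \<open>PGL(2,Z)\<close>

interpretation PGL: group PGL2Z
  by (rule group_PGL2Z)

abbreviation PGL_mult (infixl \<open>\<cdot>\<close> 70) where
  "g \<cdot> h \<equiv> g \<otimes>\<^bsub>PGL2Z\<^esub> h"

abbreviation PGL_act (infixl \<open>\<odot>\<close> 60) where
  "P \<odot> g \<equiv> P #>\<^bsub>PGL2Z\<^esub> g"

section \<open>Matrices with given entries, up to sign\<close>

definition mat2 :: "int \<Rightarrow> int \<Rightarrow> int \<Rightarrow> int \<Rightarrow> int^2^2" where
  "mat2 p q r s = vector [vector [p, q], vector [r, s]]"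

lemma mat2_sel [simp]:
  "mat2 p q r s $ 1 $ 1 = p" "mat2 p q r s $ 1 $ 2 = q"
  "mat2 p q r s $ 2 $ 1 = r" "mat2 p q r s $ 2 $ 2 = s"
  by (simp_all add: mat2_def)

lemma mat2_collapse: "mat2 (M $ 1 $ 1) (M $ 1 $ 2) (M $ 2 $ 1) (M $ 2 $ 2) = M"
  by (rule mat2_eqI) simp_all

lemma mat2_eq_iff [simp]:
  "mat2 p q r s = mat2 p' q' r' s' \<longleftrightarrow> p = p' \<and> q = q' \<and> r = r' \<and> s = s'"
  by (metis mat2_sel)

lemma mat2_mult [simp]:
  "mat2 p q r s ** mat2 p' q' r' s' =
    mat2 (p * p' + q * r') (p * q' + q * s') (r * p' + s * r') (r * q' + s * s')"
  by (rule mat2_eqI) (simp_all add: matrix_matrix_mult_def sum_2)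

lemma mat2_uminus [simp]: "- mat2 p q r s = mat2 (- p) (- q) (- r) (- s)"
  by (rule mat2_eqI) simp_all

lemma mat_eq_mat2: "mat k = mat2 k 0 0 k"
  by (rule mat2_eqI) (simp_all add: mat_def)

lemma invertible_mat2_iff:
  "invertible (mat2 p q r s) \<longleftrightarrow> p * s - q * r = 1 \<or> p * s - q * r = - 1"
proof
  assume "invertible (mat2 p q r s)"
  then obtain N where "mat2 p q r s ** N = mat 1" by (auto simp: invertible_def)
  then have "det (mat2 p q r s) * det N = 1" by (metis det_I det_mul)
  then show "p * s - q * r = 1 \<or> p * s - q * r = - 1"
    by (auto simp: det_2 zmult_eq_1_iff)
next
  define D where "D = p * s - q * r"
  assume "p * s - q * r = 1 \<or> p * s - q * r = - 1"
  then have "D * D = 1" by (auto simp: D_def)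
  moreover have "mat2 p q r s ** mat2 (D * s) (- D * q) (- D * r) (D * p) = mat (D * D)"
    "mat2 (D * s) (- D * q) (- D * r) (D * p) ** mat2 p q r s = mat (D * D)"
    unfolding mat_eq_mat2 by (simp_all add: D_def algebra_simps)
  ultimately show "invertible (mat2 p q r s)" unfolding invertible_def by metis
qed

lemma pm_mat2_eq_iff:
  "pm (mat2 p q r s) = pm (mat2 p' q' r' s') \<longleftrightarrow>
    (p = p' \<and> q = q' \<and> r = r' \<and> s = s') \<or> (p = - p' \<and> q = - q' \<and> r = - r' \<and> s = - s')"
  by (auto simp: pm_eq doubleton_eq_iff)

lemma one_PGL: "\<one>\<^bsub>PGL2Z\<^esub> = pm (mat2 1 0 0 1)"
  unfolding PGL2Z_def FactGroup_def pm_eq by (simp add: mat_eq_mat2)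

lemma carrier_PGL: "carrier PGL2Z = pm ` {M. invertible M}"
  by (auto simp: pm_def PGL2Z_def FactGroup_def RCOSETS_def GL2Z_def)

lemma mA_eq: "mA = pm (mat2 0 (-1) 1 0)" and mV_eq: "mV = pm (mat2 (-1) 0 0 1)"
  by (simp_all add: mA_def mV_def mat2_def)

lemma mC_eq': "mC = pm (mat2 1 1 0 1)"
  by (simp add: mC_eq mat2_def)

lemma modular_PGL: "modular_group PGL2Z mA mC mV"
  unfolding mA_eq mC_eq' mV_eq
  by (intro modular_group.intro modular_group_axioms.intro group_PGL2Z)
    (simp_all add: pm_in_carrier pm_mult invertible_mat2_iff one_PGL pm_mat2_eq_iff)

interpretation PGL: modular_group PGL2Z mA mC mV
  by (rule modular_PGL)

text \<open>The elements \<open>C\<^sup>n V\<^sup>\<epsilon>\<close>, with \<open>\<epsilon>\<close> encoded by the sign \<open>s = (-1)\<^sup>\<epsilon>\<close>.\<close>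

definition tn :: "int \<Rightarrow> int \<Rightarrow> (int^2^2) set" where
  "tn n s = pm (mat2 s n 0 1)"

lemma tn_closed: "s \<in> {1, -1} \<Longrightarrow> tn n s \<in> carrier PGL2Z"
  unfolding tn_def by (rule pm_in_carrier) (auto simp: invertible_mat2_iff)

text \<open>Matrices with rows (s, n) and (0, 1) compose like the affine maps
  \<open>x \<mapsto> s x + n\<close>.\<close>

lemma tn_mult:
  "s \<in> {1, -1} \<Longrightarrow> s' \<in> {1, -1} \<Longrightarrow> tn n s \<cdot> tn n' s' = tn (n + s * n') (s * s')"
  unfolding tn_def by (subst pm_mult) (auto simp: invertible_mat2_iff pm_mat2_eq_iff)

lemma tn_eq_iff: "s \<in> {1, -1} \<Longrightarrow> s' \<in> {1, -1} \<Longrightarrow> tn n s = tn n' s' \<longleftrightarrow> n = n' \<and> s = s'"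
  by (auto simp: tn_def pm_mat2_eq_iff)

lemma tn_one: "tn 0 1 = \<one>\<^bsub>PGL2Z\<^esub>" and mC_tn: "mC = tn 1 1" and mV_tn: "mV = tn 0 (-1)"
  by (simp_all add: tn_def one_PGL mC_eq' mV_eq)

lemma inv_tn: "s \<in> {1, -1} \<Longrightarrow> inv\<^bsub>PGL2Z\<^esub> tn n s = tn (- s * n) s"
  by (rule PGL.inv_equality) (auto simp: tn_mult tn_one tn_closed)

lemma mC_pow: "mC [^]\<^bsub>PGL2Z\<^esub> (n :: int) = tn n 1"
proof -
  have nat: "mC [^]\<^bsub>PGL2Z\<^esub> k = tn (int k) 1" for k :: nat
    by (induction k) (simp_all add: tn_one mC_tn tn_mult add.commute)
  show ?thesis
  proof (cases n rule: int_cases2)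
    case (nonneg k)
    then show ?thesis by (simp add: int_pow_int nat)
  next
    case (nonpos k)
    then show ?thesis by (simp add: PGL.int_pow_neg_int nat inv_tn)
  qed
qed

lemma mC_pow_mV_pow:
  assumes "s \<in> {1, -1}"
  shows "mC [^]\<^bsub>PGL2Z\<^esub> (n :: int) \<cdot> mV [^]\<^bsub>PGL2Z\<^esub> ((1 - s) div 2) = tn n s"
  using assms by (auto simp: mC_pow mV_tn tn_mult tn_closed)

text \<open>Euclid's algorithm on the first column: a power of \<open>C\<close> reduces its top
  entry modulo the bottom one, \<open>A\<close> exchanges the rows up to sign, and the process ends
  at an upper triangular matrix, which up to sign is some \<open>tn n s\<close>.\<close>

lemma generate_PGL: "generate PGL2Z {mA, mC, mV} = carrier PGL2Z"
proof
  let ?H = "generate PGL2Z {mA, mC, mV}"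
  show "?H \<subseteq> carrier PGL2Z" by (rule PGL.generate_incl) simp
  interpret H: subgroup ?H PGL2Z by (rule PGL.generate_is_subgroup) simp
  have mem: "mA \<in> ?H" "mC \<in> ?H" "mV \<in> ?H" by (auto intro: generate.incl)
  have T: "tn n s \<in> ?H" if "s \<in> {1, -1}" for n s
  proof -
    have "tn n 1 \<in> ?H"
      using PGL.subgroup_int_pow_closed[OF H.subgroup_axioms mem(2), of n] by (simp add: mC_pow)
    moreover from this have "tn n (-1) \<in> ?H"
      using H.m_closed[OF _ mem(3), of "tn n 1"] by (simp add: mV_tn tn_mult)
    ultimately show ?thesis using that by auto
  qed
  have main: "pm (mat2 p q r s) \<in> ?H" if "invertible (mat2 p q r s)" for p q r s
    using that
  proof (induction "nat \<bar>r\<bar>" arbitrary: p q r s rule: less_induct)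
    case less
    show ?case
    proof (cases "r = 0")
      case True
      have "p * s = 1 \<or> p * s = -1" using less.prems True by (simp add: invertible_mat2_iff)
      then have "p * s = 1 \<or> p * (- s) = 1" by auto
      then have ps: "p \<in> {1, -1}" "s \<in> {1, -1}" unfolding zmult_eq_1_iff by auto
      then have "pm (mat2 p q r s) = tn (s * q) (s * p)"
        using True by (auto simp: tn_def pm_mat2_eq_iff)
      then show ?thesis using T[of "s * p"] ps by auto
    next
      case False
      define k p' q' where "k = p div r" and "p' = p mod r" and "q' = q - k * s"
      have p: "p = k * r + p'" and q: "q = k * s + q'"
        by (simp_all add: k_def p'_def q'_def)
      have "nat \<bar>p'\<bar> < nat \<bar>r\<bar>" using False by (simp add: p'_def abs_mod_less)
      \<comment> \<open>Up to sign this is \<open>A C^(-k)\<close> times the given matrix; its lower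
        left entry is the remainder \<open>p'\<close>.\<close>
      moreover have "invertible (mat2 (- r) (- s) p' q')"
        using less.prems by (auto simp: invertible_mat2_iff p q algebra_simps)
      ultimately have "pm (mat2 (- r) (- s) p' q') \<in> ?H"
        by (rule less.hyps)
      then have "tn k 1 \<cdot> (mA \<cdot> pm (mat2 (- r) (- s) p' q')) \<in> ?H"
        using T mem by (intro H.m_closed) auto
      also have "tn k 1 \<cdot> (mA \<cdot> pm (mat2 (- r) (- s) p' q')) = pm (mat2 p q r s)"
        unfolding tn_def mA_eq
        using less.prems
        by (simp add: pm_mult invertible_mat2_iff pm_mat2_eq_iff p q algebra_simps)
      finally show ?thesis .
    qed
  qed
  show "carrier PGL2Z \<subseteq> ?H"
    using main mat2_collapse unfolding carrier_PGL by (metis image_subsetI mem_Collect_eq)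
qed

lemma mD_eq: "PGL.d = pm (mat2 1 0 1 1)"
proof -
  have "inv\<^bsub>PGL2Z\<^esub> mC = tn (-1) 1" by (simp add: mC_tn inv_tn)
  then show ?thesis unfolding PGL.d_def
    by (simp add: mA_eq tn_def pm_mult invertible_mat2_iff pm_mat2_eq_iff)
qed

text \<open>An element of the kernel of the projection to PGL(2,Z) has the normal form
  \<open>k w l\<close>. The letters \<open>c\<close> and \<open>d\<close> of \<open>w\<close> project to unipotent nonnegative matrices,
  so a nonempty product \<open>w\<close> has too large entries to project into \<open>K\<close>.\<close>

lemma generate_DirProd_trivial:
  assumes "modular_group H a c v"
    and mem: "(\<one>\<^bsub>PGL2Z\<^esub>, h) \<in> generate (PGL2Z \<times>\<times> H) {(mA, a), (mC, c), (mV, v)}"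
  shows "h = \<one>\<^bsub>H\<^esub>"
proof -
  interpret H: modular_group H a c v by fact
  interpret P: modular_group "PGL2Z \<times>\<times> H" "(mA, a)" "(mC, c)" "(mV, v)"
    by (rule modular_group_DirProd[OF modular_PGL assms(1)])
  obtain k w l where k: "k \<in> P.K" and w: "w \<in> P.W" and l: "l \<in> P.K"
    and eq: "(\<one>\<^bsub>PGL2Z\<^esub>, h) = k \<otimes>\<^bsub>PGL2Z \<times>\<times> H\<^esub> w \<otimes>\<^bsub>PGL2Z \<times>\<times> H\<^esub> l"
    using P.normal_form[OF mem] by blast
  have K: "\<exists>p q r s. fst x = pm (mat2 p q r s) \<and> \<bar>p\<bar> + \<bar>q\<bar> + \<bar>r\<bar> + \<bar>s\<bar> = 2" if "x \<in> P.K" for x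
  proof -
    have "fst x \<in> {pm (mat2 1 0 0 1), pm (mat2 0 (-1) 1 0), pm (mat2 (-1) 0 0 1),
        pm (mat2 0 (-1) (-1) 0)}"
      using that unfolding P.K_def
      by (auto simp: one_PGL mA_eq mV_eq pm_mult invertible_mat2_iff)
    then show ?thesis
      by (elim insertE emptyE) ((rule exI)+, erule conjI, simp)+
  qed
  \<comment> \<open>A letter \<open>c\<close> or \<open>d\<close> adds one column of a nonnegative
    matrix to the other, so the sum of the entries does not drop. It is 3 for one letter, against 2
    for the absolute values in \<open>K\<close>. Invertibility is carried along for
    \<open>pm_mult\<close>.\<close>
  have W: "x = \<one>\<^bsub>PGL2Z \<times>\<times> H\<^esub> \<or> (\<exists>p q r s. fst x = pm (mat2 p q r s) \<and> invertible (mat2 p q r s) \<and>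
      p \<ge> 0 \<and> q \<ge> 0 \<and> r \<ge> 0 \<and> s \<ge> 0 \<and> p + q + r + s \<ge> 3)" (is "_ \<or> ?Q x") if "x \<in> P.W" for x
    using that
  proof induction
    case (c w)
    have fst: "fst (w \<otimes>\<^bsub>PGL2Z \<times>\<times> H\<^esub> (mC, c)) = fst w \<cdot> pm (mat2 1 1 0 1)"
      by (simp add: mult_DirProd' mC_eq')
    from c.IH have "?Q (w \<otimes>\<^bsub>PGL2Z \<times>\<times> H\<^esub> (mC, c))"
    proof
      assume "w = \<one>\<^bsub>PGL2Z \<times>\<times> H\<^esub>"
      then show ?thesis
        unfolding fst by (intro exI[of _ 1] exI[of _ 0])
          (auto simp: one_PGL pm_mult invertible_mat2_iff)
    next
      assume "?Q w"
      then obtain p q r s where "fst w = pm (mat2 p q r s)" "invertible (mat2 p q r s)"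
        "p \<ge> 0" "q \<ge> 0" "r \<ge> 0" "s \<ge> 0" "p + q + r + s \<ge> 3" by blast
      then show ?thesis
        unfolding fst
        using invertible_mult[of "mat2 p q r s" "mat2 1 1 0 1"]
        by (intro exI[of _ p] exI[of _ "p + q"] exI[of _ r] exI[of _ "r + s"])
          (simp add: pm_mult invertible_mat2_iff[of 1])
    qed
    then show ?case ..
  next
    case (d w)
    have "fst P.d = PGL.d" by (simp add: P.d_def PGL.d_def inv_DirProd H.is_group)
    then have fst: "fst (w \<otimes>\<^bsub>PGL2Z \<times>\<times> H\<^esub> P.d) = fst w \<cdot> pm (mat2 1 0 1 1)"
      by (simp add: mult_DirProd' mD_eq)
    from d.IH have "?Q (w \<otimes>\<^bsub>PGL2Z \<times>\<times> H\<^esub> P.d)"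
    proof
      assume "w = \<one>\<^bsub>PGL2Z \<times>\<times> H\<^esub>"
      then show ?thesis
        unfolding fst by (intro exI[of _ 1] exI[of _ 0])
          (auto simp: one_PGL pm_mult invertible_mat2_iff)
    next
      assume "?Q w"
      then obtain p q r s where "fst w = pm (mat2 p q r s)" "invertible (mat2 p q r s)"
        "p \<ge> 0" "q \<ge> 0" "r \<ge> 0" "s \<ge> 0" "p + q + r + s \<ge> 3" by blast
      then show ?thesis
        unfolding fst
        using invertible_mult[of "mat2 p q r s" "mat2 1 0 1 1"]
        by (intro exI[of _ "p + q"] exI[of _ q] exI[of _ "r + s"] exI[of _ s])
          (simp add: pm_mult invertible_mat2_iff[of 1])
    qed
    then show ?case ..
  qed (simp)
  \<comment> \<open>From \<open>k w l = (1, h)\<close>, the first component of \<open>w\<close> is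
    that of \<open>inv k inv l\<close>, an element of \<open>K\<close>.\<close>
  let ?m = "inv\<^bsub>PGL2Z \<times>\<times> H\<^esub> k \<otimes>\<^bsub>PGL2Z \<times>\<times> H\<^esub> inv\<^bsub>PGL2Z \<times>\<times> H\<^esub> l"
  have m: "?m \<in> P.K" using k l by (intro P.K_mult P.K_inv)
  have hc: "h \<in> carrier H"
    using eq k w l P.K_closed P.W_closed
    by (metis P.m_closed carrier_DirProd mem_Sigma_iff)
  have "fst w = fst (inv\<^bsub>PGL2Z \<times>\<times> H\<^esub> k
      \<otimes>\<^bsub>PGL2Z \<times>\<times> H\<^esub> (k \<otimes>\<^bsub>PGL2Z \<times>\<times> H\<^esub> w \<otimes>\<^bsub>PGL2Z \<times>\<times> H\<^esub> l)
      \<otimes>\<^bsub>PGL2Z \<times>\<times> H\<^esub> inv\<^bsub>PGL2Z \<times>\<times> H\<^esub> l)"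
    using k w l P.K_closed P.W_closed by (simp add: P.m_assoc del: carrier_DirProd one_DirProd)
      (simp add: P.m_assoc [symmetric] del: carrier_DirProd one_DirProd)
  also have "\<dots> = fst ?m"
    unfolding eq [symmetric] using P.K_closed[OF P.K_inv[OF k]] P.K_closed[OF P.K_inv[OF l]]
    by (auto simp: mult_DirProd')
  finally have "fst w = fst ?m" .
  then have "w = \<one>\<^bsub>PGL2Z \<times>\<times> H\<^esub>"
    using W[OF w] K[OF m] by (auto simp: pm_mat2_eq_iff)
  then have "(\<one>\<^bsub>PGL2Z\<^esub>, h) = k \<otimes>\<^bsub>PGL2Z \<times>\<times> H\<^esub> l"
    using eq k l by (simp del: one_DirProd carrier_DirProd)
  moreover have "k \<otimes>\<^bsub>PGL2Z \<times>\<times> H\<^esub> l \<in> P.K" using k l by (rule P.K_mult)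
  ultimately have "(\<one>\<^bsub>PGL2Z\<^esub>, h) \<in> P.K" by simp
  \<comment> \<open>The three nontrivial elements of \<open>K\<close> have nontrivial first
    components.\<close>
  then show ?thesis unfolding P.K_def
    by (auto simp: one_PGL mA_eq mV_eq pm_mult invertible_mat2_iff pm_mat2_eq_iff)
qed

text \<open>The subgroup generated by the three pairs is the graph of \<open>\<rho>\<close>: it
  meets every fiber because \<open>mA\<close>, \<open>mC\<close>, \<open>mV\<close> generate, and
  only once because two of its elements over the same \<open>g\<close> differ by some
  \<open>(1, h)\<close>, to which \<open>generate_DirProd_trivial\<close> applies.\<close>

theorem PGL_hom_exists:
  assumes "modular_group H a c v"
  obtains \<rho> where "\<rho> \<in> hom PGL2Z H" "\<rho> mA = a" "\<rho> mC = c" "\<rho> mV = v"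
proof -
  interpret H: modular_group H a c v by fact
  interpret P: modular_group "PGL2Z \<times>\<times> H" "(mA, a)" "(mC, c)" "(mV, v)"
    by (rule modular_group_DirProd[OF modular_PGL assms(1)])
  let ?R = "generate (PGL2Z \<times>\<times> H) {(mA, a), (mC, c), (mV, v)}"
  interpret R: subgroup ?R "PGL2Z \<times>\<times> H" by (rule P.generate_is_subgroup) simp
  have gens: "(mA, a) \<in> ?R" "(mC, c) \<in> ?R" "(mV, v) \<in> ?R" by (auto intro: generate.incl)
  have mult: "(g \<cdot> g', h \<otimes>\<^bsub>H\<^esub> h') \<in> ?R" if "(g, h) \<in> ?R" "(g', h') \<in> ?R" for g h g' h'
    using R.m_closed[OF that] by simp
  have ex: "\<exists>h. (g, h) \<in> ?R" if "g \<in> carrier PGL2Z" for g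
    using that unfolding generate_PGL [symmetric]
  proof (induction rule: PGL.generate_induct)
    case one
    show ?case using R.one_closed by auto
  qed (use mult gens in blast)+
  have unique: "h = h'" if "(g, h) \<in> ?R" "(g, h') \<in> ?R" for g h h'
  proof -
    have c: "g \<in> carrier PGL2Z" "h \<in> carrier H" "h' \<in> carrier H"
      using R.subset that by auto
    have "inv\<^bsub>PGL2Z \<times>\<times> H\<^esub> (g, h) \<otimes>\<^bsub>PGL2Z \<times>\<times> H\<^esub> (g, h') \<in> ?R"
      using that by blast
    then have "inv\<^bsub>H\<^esub> h \<otimes>\<^bsub>H\<^esub> h' = \<one>\<^bsub>H\<^esub>"
      using c by (intro generate_DirProd_trivial[OF assms]) (simp add: H.is_group)
    then show "h = h'" using c by (metis H.inv_closed H.inv_equality H.inv_inv)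
  qed
  define \<rho> where "\<rho> g = (THE h. (g, h) \<in> ?R)" for g
  have \<rho>: "\<rho> g = h" if "(g, h) \<in> ?R" for g h
    unfolding \<rho>_def using that unique by blast
  have "\<rho> \<in> hom PGL2Z H"
  proof (rule homI)
    fix g assume "g \<in> carrier PGL2Z"
    then show "\<rho> g \<in> carrier H" using ex \<rho> R.subset by fastforce
  next
    fix g g' assume "g \<in> carrier PGL2Z" "g' \<in> carrier PGL2Z"
    then obtain h h' where h: "(g, h) \<in> ?R" "(g', h') \<in> ?R" using ex by blast
    then show "\<rho> (g \<cdot> g') = \<rho> g \<otimes>\<^bsub>H\<^esub> \<rho> g'" using \<rho> mult by metis
  qed
  then show thesis using that \<rho> gens by blast
qed

section \<open>The coset graph of a Neumann subgroup\<close>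

lemma That_eq: "That = {tn n s | n s. s \<in> {1, -1}}"
proof -
  have *: "mC [^]\<^bsub>PGL2Z\<^esub> n \<cdot> mV [^]\<^bsub>PGL2Z\<^esub> \<epsilon> = tn n (1 - 2 * \<epsilon>)" if "\<epsilon> \<in> {0, 1}" for n \<epsilon> :: int
    using that mC_pow_mV_pow[of "1 - 2 * \<epsilon>" n] by auto
  show ?thesis
  proof (intro equalityI subsetI)
    fix x assume "x \<in> That"
    then obtain n \<epsilon> :: int where "\<epsilon> \<in> {0, 1}" "x = tn n (1 - 2 * \<epsilon>)"
      unfolding That_def using * by blast
    moreover from this have "1 - 2 * \<epsilon> \<in> {1, -1}" by auto
    ultimately show "x \<in> {tn n s | n s. s \<in> {1, -1}}" by blast
  next
    fix x assume "x \<in> {tn n s | n s. s \<in> {1, -1}}"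
    then obtain n s where s: "s \<in> {1, -1}" "x = tn n s" by blast
    then have "(1 - s) div 2 \<in> {0, 1}" by auto
    then show "x \<in> That" unfolding That_def using mC_pow_mV_pow[OF s(1), of n] s(2) by blast
  qed
qed

text \<open>The sign \<open>s = (-1)^\<epsilon>\<close> replaces the exponent of \<open>V\<close>,
  so that adding exponents modulo 2 becomes multiplying signs.\<close>

definition vx :: "(int^2^2) set set \<Rightarrow> int \<Rightarrow> int \<Rightarrow> (int^2^2) set set" where
  "vx S n s = S \<odot> tn n s"

lemma vertex_eq_vx: "\<epsilon> \<in> {0, 1} \<Longrightarrow> vertex S n \<epsilon> = vx S n (1 - 2 * \<epsilon>)"
  using mC_pow_mV_pow[of "1 - 2 * \<epsilon>" n] by (auto simp: vertex_def vx_def)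

section \<open>Coordinates of cosets and the action of the generators\<close>

locale neumann =
  fixes S :: "(int^2^2) set set"
  assumes neumann: "neumann_subgroup S"
begin

sublocale S: subgroup S PGL2Z
  using neumann by (simp add: neumann_subgroup_def)

abbreviation \<iota> where "\<iota> \<equiv> iota S"
abbreviation \<delta> where "\<delta> \<equiv> delta S"
abbreviation \<Sigma> where "\<Sigma> \<equiv> Sigma_gen S"

lemma S_subset: "S \<subseteq> carrier PGL2Z"
  by (rule S.subset)

lemma tn_in_S_iff: "s \<in> {1, -1} \<Longrightarrow> tn n s \<in> S \<longleftrightarrow> n = 0 \<and> s = 1"
proof
  assume s: "s \<in> {1, -1}" and "tn n s \<in> S"
  then have "tn n s \<in> S \<inter> That" by (auto simp: That_eq)
  then have "tn n s = tn 0 1" using neumann unfolding neumann_subgroup_def tn_one by blast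
  then show "n = 0 \<and> s = 1" using s by (simp add: tn_eq_iff)
qed (simp add: tn_one)

lemma vx_act: "s \<in> {1, -1} \<Longrightarrow> g \<in> carrier PGL2Z \<Longrightarrow> vx S n s \<odot> g = S \<odot> (tn n s \<cdot> g)"
  by (simp add: vx_def PGL.coset_mult_assoc S_subset tn_closed)

text \<open>Two elements of \<open>That\<close> with the same coset have a quotient in
  \<open>S \<inter> That\<close>, which is trivial.\<close>

lemma vx_eq_iff:
  assumes "s \<in> {1, -1}" "s' \<in> {1, -1}"
  shows "vx S n s = vx S n' s' \<longleftrightarrow> n = n' \<and> s = s'"
proof
  assume "vx S n s = vx S n' s'"
  then have "vx S n s \<odot> inv\<^bsub>PGL2Z\<^esub> tn n' s' = vx S n' s' \<odot> inv\<^bsub>PGL2Z\<^esub> tn n' s'"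
    by simp
  then have "S \<odot> (tn n s \<cdot> inv\<^bsub>PGL2Z\<^esub> tn n' s') = S"
    using assms by (simp only: vx_act tn_closed PGL.inv_closed PGL.r_inv
        PGL.coset_mult_one[OF S_subset])
  then have "tn n s \<cdot> inv\<^bsub>PGL2Z\<^esub> tn n' s' \<in> S"
    using assms PGL.coset_join1[OF _ _ S.subgroup_axioms]
    by (metis PGL.inv_closed PGL.m_closed S_subset tn_closed)
  then have "tn (n - s * s' * n') (s * s') \<in> S"
    using assms by (auto simp: inv_tn tn_mult)
  then show "n = n' \<and> s = s'"
    using assms by (subst (asm) tn_in_S_iff) auto
qed simp

lemma coset_eq_vx:
  assumes "g \<in> carrier PGL2Z"
  obtains n s where "s \<in> {1, -1}" "S \<odot> g = vx S n s"
proof -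
  have "g \<in> S <#>\<^bsub>PGL2Z\<^esub> That" using assms neumann by (simp add: neumann_subgroup_def)
  then obtain h n s where *: "h \<in> S" "s \<in> {1, -1}" "g = h \<cdot> tn n s"
    unfolding set_mult_def That_eq by blast
  then have "S \<odot> g = vx S n s"
    by (simp add: vx_def PGL.coset_mult_assoc [symmetric] S_subset tn_closed
      PGL.coset_join2 S.subgroup_axioms)
  then show thesis using * that by blast
qed

text \<open>The definite description behind \<open>iota_delta\<close> is justified here:
  \<open>coset_eq_vx\<close> gives existence and \<open>vx_eq_iff\<close> uniqueness.\<close>

lemma delta_cases: "\<delta> n \<in> {1, -1}"
  and vx_A1: "vx S n 1 \<odot> mA = vx S (\<iota> n) (\<delta> n)"
proof -
  obtain k d where kd: "d \<in> {1, -1}" "vx S n 1 \<odot> mA = vx S k d"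
    by (rule coset_eq_vx[of "tn n 1 \<cdot> mA"]) (auto simp: vx_act tn_closed)
  have *: "vertex S k' ((1 - d') div 2) = vx S k' d'" if "d' \<in> {-1, 1}" for k' d' :: int
    using that by (auto simp: vertex_eq_vx)
  have v0: "vertex S n 0 = vx S n 1" by (simp add: vertex_eq_vx)
  have "d \<in> {-1, 1}" using kd(1) by auto
  have "iota_delta S n = (k, d)"
    unfolding iota_delta_def
  proof (rule the_equality)
    show "case (k, d) of (k, d) \<Rightarrow> d \<in> {-1, 1} \<and> vertex S n 0 \<odot> mA = vertex S k ((1 - d) div 2)"
      using kd(2) \<open>d \<in> {-1, 1}\<close> by (simp only: case_prod_conv simp_thms v0 *)
  next
    fix p assume p: "case p of (k, d) \<Rightarrow> d \<in> {-1, 1} \<and> vertex S n 0 \<odot> mA = vertex S k ((1 - d) div 2)"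
    obtain k' d' where [simp]: "p = (k', d')" by fastforce
    have d': "d' \<in> {-1, 1}" using p by simp
    then have "vx S k d = vx S k' d'" using p kd(2) *[OF d'] by (simp add: v0)
    then show "p = (k, d)" using kd(1) d' by (subst (asm) vx_eq_iff) auto
  qed
  then show "\<delta> n \<in> {1, -1}" "vx S n 1 \<odot> mA = vx S (\<iota> n) (\<delta> n)"
    using kd by (simp_all add: iota_def delta_def)
qed

lemma delta_sq [simp]: "\<delta> n * \<delta> n = 1" "\<delta> n * (\<delta> n * x) = x"
  using delta_cases[of n] by auto

lemma sign_mult: "s \<in> {1, -1} \<Longrightarrow> s * \<delta> n \<in> {1, -1}"
  using delta_cases[of n] by auto

text \<open>\<open>V\<close> inverts \<open>C\<close> by conjugation, so the sign gives the
  direction in which \<open>C\<close> shifts.\<close>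

lemma vx_C: "s \<in> {1, -1} \<Longrightarrow> vx S n s \<odot> mC = vx S (n + s) s"
  by (subst vx_act) (auto simp: vx_def mC_tn tn_mult tn_closed)

lemma vx_V: "s \<in> {1, -1} \<Longrightarrow> vx S n s \<odot> mV = vx S n (- s)"
  by (subst vx_act) (auto simp: vx_def mV_tn tn_mult tn_closed)

lemma vx_mult:
  assumes "s \<in> {1, -1}" "g \<in> carrier PGL2Z" "h \<in> carrier PGL2Z"
  shows "vx S n s \<odot> (g \<cdot> h) = vx S n s \<odot> g \<odot> h"
proof -
  have "vx S n s \<subseteq> carrier PGL2Z"
    unfolding vx_def using assms by (intro PGL.r_coset_subset_G S_subset tn_closed)
  then show ?thesis using assms by (simp add: PGL.coset_mult_assoc)
qed

lemma vx_one: "s \<in> {1, -1} \<Longrightarrow> vx S n s \<odot> \<one>\<^bsub>PGL2Z\<^esub> = vx S n s"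
  by (subst vx_act) (auto simp: vx_def tn_closed)

text \<open>\<open>A\<close> commutes with \<open>V\<close>, so negating the sign of a vertex
  negates the sign of its image; this leaves the case \<open>s = 1\<close>.\<close>

lemma vx_A:
  assumes "s \<in> {1, -1}"
  shows "vx S n s \<odot> mA = vx S (\<iota> n) (s * \<delta> n)"
proof (cases "s = 1")
  case False
  then have "vx S n s \<odot> mA = vx S n 1 \<odot> mV \<odot> mA"
    using assms by (simp add: vx_V)
  also have "\<dots> = vx S n 1 \<odot> mA \<odot> mV"
    by (simp add: vx_mult [symmetric] PGL.va)
  finally show ?thesis
    using False assms delta_cases[of n] by (simp add: vx_A1 vx_V)
qed (simp add: vx_A1)

lemma vx_B:
  assumes "s \<in> {1, -1}"
  shows "vx S n s \<odot> mB = vx S (\<iota> n + s * \<delta> n) (s * \<delta> n)"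
proof -
  have "mB \<in> carrier PGL2Z"
    unfolding mB_def using pm_in_carrier invertible_mat2_iff[of 0 "-1" 1 1] by (simp add: mat2_def)
  then have B: "mB = mA \<cdot> mC" by (simp add: mC_def)
  have "vx S n s \<odot> mB = vx S n s \<odot> mA \<odot> mC"
    unfolding B by (intro vx_mult assms PGL.closed)
  then show ?thesis using assms sign_mult[OF assms] by (simp only: vx_A vx_C)
qed

section \<open>Relations between \<iota> and \<delta>\<close>

lemma iota_iota: "\<iota> (\<iota> n) = n" and delta_iota: "\<delta> (\<iota> n) = \<delta> n"
proof -
  have "vx S n 1 = vx S n 1 \<odot> (mA \<cdot> mA)"
    by (simp add: PGL.aa vx_one)
  also have "\<dots> = vx S (\<iota> (\<iota> n)) (\<delta> n * \<delta> (\<iota> n))"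
    using delta_cases[of n] by (simp add: vx_mult vx_A)
  finally have "n = \<iota> (\<iota> n) \<and> 1 = \<delta> n * \<delta> (\<iota> n)"
    using sign_mult[OF delta_cases] by (subst (asm) vx_eq_iff) auto
  then show "\<iota> (\<iota> n) = n" "\<delta> (\<iota> n) = \<delta> n"
    using delta_cases[of n] delta_cases[of "\<iota> n"] by auto
qed

lemma mB_eq: "mB = pm (mat2 0 (-1) 1 1)"
  by (simp add: mB_def mat2_def)

lemma mB_closed [simp]: "mB \<in> carrier PGL2Z"
  by (simp add: mB_eq pm_in_carrier invertible_mat2_iff)

lemma mB_cube: "mB \<cdot> mB \<cdot> mB = \<one>\<^bsub>PGL2Z\<^esub>"
  by (simp add: mB_eq pm_mult invertible_mat2_iff one_PGL pm_mat2_eq_iff)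

text \<open>By \<open>mB_cube\<close> the orbit closes after three steps; comparing the coordinates
  of the third image with those of the start gives the two equations.\<close>

lemma B_orbit:
  assumes s: "s \<in> {1, -1}"
    and s': "s' = s * \<delta> n" and n': "n' = \<iota> n + s'"
    and s'': "s'' = s' * \<delta> n'" and n'': "n'' = \<iota> n' + s''"
  shows "vx S n s \<odot> mB = vx S n' s'" "vx S n' s' \<odot> mB = vx S n'' s''"
    "vx S n'' s'' \<odot> mB = vx S n s"
    "\<iota> n'' + s = n" "s'' * \<delta> n'' = s"
proof -
  have sgn: "s' \<in> {1, -1}" "s'' \<in> {1, -1}" "s'' * \<delta> n'' \<in> {1, -1}"
    unfolding s' s'' by (intro sign_mult s)+
  show 1: "vx S n s \<odot> mB = vx S n' s'"
    by (simp only: vx_B[OF s] s' n')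
  show 2: "vx S n' s' \<odot> mB = vx S n'' s''"
    by (simp only: vx_B[OF sgn(1)] s'' n'')
  note 3 = vx_B[OF sgn(2), of n'']
  have "vx S n s = vx S n s \<odot> (mB \<cdot> mB \<cdot> mB)"
    unfolding mB_cube vx_one[OF s] ..
  also have "\<dots> = vx S (\<iota> n'' + s'' * \<delta> n'') (s'' * \<delta> n'')"
    by (simp only: vx_mult[OF s] mB_closed PGL.m_closed 1 2 3)
  finally have 4: "vx S (\<iota> n'' + s'' * \<delta> n'') (s'' * \<delta> n'') = vx S n s" ..
  then show "vx S n'' s'' \<odot> mB = vx S n s" unfolding 3 .
  show "s'' * \<delta> n'' = s" "\<iota> n'' + s = n"
    using 4 unfolding vx_eq_iff[OF sgn(3) s] by auto
qed

text \<open>The orbit is started at \<open>(n, 1)\<close>. Its closing equation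
  \<open>\<iota> n'' + 1 = n\<close> identifies the third index as \<open>\<iota> (n - 1)\<close>,
  and the signs around the orbit multiply to 1.\<close>

lemma delta_step: "\<delta> n * \<delta> (\<iota> n + \<delta> n) = \<delta> (n - 1)"
  and iota_step: "\<iota> (\<iota> n + \<delta> n) = \<iota> (n - 1) - \<delta> (n - 1)"
proof -
  let ?n' = "\<iota> n + \<delta> n"
  let ?s'' = "\<delta> n * \<delta> ?n'"
  let ?n'' = "\<iota> ?n' + ?s''"
  have *: "\<iota> ?n'' + 1 = n" "?s'' * \<delta> ?n'' = 1"
    by (rule B_orbit[of 1 "\<delta> n"]; simp)+
  have n'': "?n'' = \<iota> (n - 1)" using *(1) by (metis add_diff_cancel_right' iota_iota)
  then have "\<delta> ?n'' = \<delta> (n - 1)" by (simp only: delta_iota)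
  then have "?s'' * \<delta> (n - 1) * \<delta> (n - 1) = \<delta> (n - 1)" using *(2) by simp
  then show s: "?s'' = \<delta> (n - 1)" by (simp only: mult.assoc delta_sq mult_1_right)
  show "\<iota> ?n' = \<iota> (n - 1) - \<delta> (n - 1)" using n'' unfolding s by simp
qed

text \<open>Along the orbit the sign is multiplied by \<delta> at each of the three vertices and
  then returns to its initial value.\<close>

lemma B_cycle_delta:
  assumes K: "B_cycle S K"
    and s: "sk \<in> {1, -1}" "sl \<in> {1, -1}" "sm \<in> {1, -1}"
    and dist: "distinct [vx S k sk, vx S l sl, vx S m sm]"
    and sub: "{vx S k sk, vx S l sl, vx S m sm} \<subseteq> K"
  shows "\<delta> k * \<delta> l * \<delta> m = 1"
proof -
  obtain P where P: "P \<in> rcosets\<^bsub>PGL2Z\<^esub> S" "K = {P \<odot> (mB [^]\<^bsub>PGL2Z\<^esub> i) | (i::int). True}"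
    using K unfolding B_cycle_def by blast
  then obtain g where "g \<in> carrier PGL2Z" "P = S \<odot> g" by (auto simp: RCOSETS_def)
  then obtain n0 s0 where ns: "s0 \<in> {1, -1}" "P = vx S n0 s0" using coset_eq_vx by metis
  define s1 n1 s2 n2 where defs: "s1 = s0 * \<delta> n0" "n1 = \<iota> n0 + s1" "s2 = s1 * \<delta> n1" "n2 = \<iota> n1 + s2"
  note orb = B_orbit[OF ns(1) defs]
  have sgn: "s1 \<in> {1, -1}" "s2 \<in> {1, -1}" unfolding defs(1,3) by (intro sign_mult ns(1))+
  let ?O = "{vx S n0 s0, vx S n1 s1, vx S n2 s2}"
  have inv: "inv\<^bsub>PGL2Z\<^esub> mB = mB \<cdot> mB"
    using mB_cube by (intro PGL.inv_equality) auto
  \<comment> \<open>In the downward induction, one step back is two steps forward because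
    \<open>B^(-1) = B^2\<close>.\<close>
  have orbit: "vx S n0 s0 \<odot> (mB [^]\<^bsub>PGL2Z\<^esub> i) \<in> ?O" for i :: int
  proof (induction i rule: int_induct[where k = 0])
    case base
    show ?case using vx_one[OF ns(1)] by simp
  next
    case (step1 i)
    have "vx S n0 s0 \<odot> (mB [^]\<^bsub>PGL2Z\<^esub> (i + 1)) = vx S n0 s0 \<odot> (mB [^]\<^bsub>PGL2Z\<^esub> i) \<odot> mB"
      by (simp add: PGL.int_pow_mult vx_mult[OF ns(1)])
    then show ?case using step1(2) orb(1-3) by (elim insertE emptyE) simp_all
  next
    case (step2 i)
    have "vx S n0 s0 \<odot> (mB [^]\<^bsub>PGL2Z\<^esub> (i - 1)) = vx S n0 s0 \<odot> (mB [^]\<^bsub>PGL2Z\<^esub> i) \<odot> mB \<odot> mB"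
      by (simp add: PGL.int_pow_diff inv PGL.m_assoc [symmetric] vx_mult[OF ns(1)])
    then show ?case using step2(2) orb(1-3) by (elim insertE emptyE) simp_all
  qed
  then have "K \<subseteq> ?O" using P(2) ns(2) by auto
  then have "vx S k sk \<in> ?O" "vx S l sl \<in> ?O" "vx S m sm \<in> ?O" using sub by auto
  then have mem: "(k, sk) \<in> {(n0, s0), (n1, s1), (n2, s2)}"
    "(l, sl) \<in> {(n0, s0), (n1, s1), (n2, s2)}"
    "(m, sm) \<in> {(n0, s0), (n1, s1), (n2, s2)}"
    using s ns(1) sgn by (simp_all add: vx_eq_iff)
  \<comment> \<open>Three distinct pairs among three are a permutation of them, so the products of
    \<delta> agree.\<close>
  have "distinct [(k, sk), (l, sl), (m, sm)]" using dist by auto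
  then have "\<delta> k * \<delta> l * \<delta> m = \<delta> n0 * \<delta> n1 * \<delta> n2"
    using mem by (auto simp: mult_ac)
  also have "s0 * (\<delta> n0 * \<delta> n1 * \<delta> n2) = s0"
    using orb(5) unfolding defs(1,3) by (simp only: mult.assoc)
  then have "\<delta> n0 * \<delta> n1 * \<delta> n2 = 1" using ns(1) by auto
  finally show ?thesis .
qed

end

section \<open>Presentations\<close>

definition word_value :: "('a, 'b) monoid_scheme \<Rightarrow> ('i \<Rightarrow> 'a) \<Rightarrow> 'i word \<Rightarrow> 'a" where
  "word_value G s u = foldr (\<lambda>(i, b) x. (if b then s i else inv\<^bsub>G\<^esub> s i) \<otimes>\<^bsub>G\<^esub> x) u \<one>\<^bsub>G\<^esub>"

lemma word_value_Nil [simp]: "word_value G s [] = \<one>\<^bsub>G\<^esub>"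
  and word_value_Cons [simp]:
    "word_value G s ((i, b) # u) = (if b then s i else inv\<^bsub>G\<^esub> s i) \<otimes>\<^bsub>G\<^esub> word_value G s u"
  by (simp_all add: word_value_def)

context group
begin

lemma word_value_closed [simp]:
  assumes "\<And>i. s i \<in> carrier G"
  shows "word_value G s u \<in> carrier G"
  using assms by (induction u) (auto simp: word_value_def)

lemma word_value_append:
  assumes "\<And>i. s i \<in> carrier G"
  shows "word_value G s (u @ v) = word_value G s u \<otimes> word_value G s v"
proof (induction u)
  case (Cons x u)
  then show ?case using assms by (cases x) (simp add: m_assoc)
qed (simp add: assms)

lemma word_value_free_eq:
  assumes "\<And>i. s i \<in> carrier G" "free_eq u v"
  shows "word_value G s u = word_value G s v"
  using assms(2)
proof induction
  case (free_eq_cancel u i b v)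
  then show ?case
    using assms(1) by (cases b) (simp_all add: word_value_append m_assoc [symmetric])
qed simp_all

text \<open>Evaluation of words descends to the free group. Its kernel is a normal subgroup
  containing the relators, hence contains their normal closure, and \<open>ker\<close> gives the
  other inclusion; the first isomorphism theorem concludes.\<close>

lemma presentationI:
  assumes s: "\<And>i. s i \<in> carrier G"
    and rel: "\<And>r. r \<in> R \<Longrightarrow> word_value G s r = \<one>"
    and onto: "\<And>x. x \<in> carrier G \<Longrightarrow> \<exists>u. word_value G s u = x"
    and ker: "\<And>u. word_value G s u = \<one> \<Longrightarrow> free_class u \<in> normal_closure free_group (free_class ` R)"
  shows "is_presentation G s R"
proof -
  interpret F: group "free_group :: 'c word set monoid" by (rule group_free_group)
  let ?F = "free_group :: 'c word set monoid"
  let ?N = "normal_closure ?F (free_class ` R)"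
  have N: "?N \<lhd> ?F"
    by (rule normal_normal_closure) (auto simp: F.is_group free_group_sel)
  define h where "h P = the_elem (word_value G s ` P)" for P
  have h: "h (free_class u) = word_value G s u" for u
  proof -
    have "word_value G s v = word_value G s u" if "v \<in> free_class u" for v
      using word_value_free_eq[OF s, where u = u and v = v] that by (simp add: free_class_def)
    moreover have "u \<in> free_class u" by (simp add: free_class_def free_eq_refl)
    ultimately have "word_value G s ` free_class u = {word_value G s u}" by blast
    then show ?thesis by (simp add: h_def)
  qed
  have carrier: "carrier ?F = range free_class" by (rule free_group_sel)
  have "h \<in> hom ?F G"
    by (rule homI) (auto simp: carrier h free_group_mult word_value_append s)
  then interpret h: group_hom ?F G h by unfold_locales
  have "kernel ?F G h = ?N"
  proof
    show "kernel ?F G h \<subseteq> ?N" by (auto simp: kernel_def carrier h ker)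
    have "free_class ` R \<subseteq> kernel ?F G h" by (auto simp: kernel_def carrier h rel)
    then show "?N \<subseteq> kernel ?F G h"
      unfolding normal_closure_def using h.normal_kernel by blast
  qed
  moreover have "h ` carrier ?F = carrier G"
  proof
    show "h ` carrier ?F \<subseteq> carrier G" by (auto simp: carrier h s)
    show "carrier G \<subseteq> h ` carrier ?F"
    proof
      fix x assume "x \<in> carrier G"
      then obtain u where "h (free_class u) = x" using onto h by auto
      then show "x \<in> h ` carrier ?F" unfolding carrier by blast
    qed
  qed
  ultimately have iso: "(\<lambda>X. the_elem (h ` X)) \<in> iso (?F Mod ?N) G"
    using h.FactGroup_iso_set by simp
  have "the_elem (h ` (?N #>\<^bsub>?F\<^esub> free_class [(i, True)])) = s i" for i
  proof -
    have "h ` (?N #>\<^bsub>?F\<^esub> free_class [(i, True)]) = {s i}"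
    proof (intro equalityI subsetI)
      fix x assume "x \<in> h ` (?N #>\<^bsub>?F\<^esub> free_class [(i, True)])"
      then obtain n where n: "n \<in> ?N" "x = h (n \<otimes>\<^bsub>?F\<^esub> free_class [(i, True)])"
        by (auto simp: r_coset_def)
      then have "n \<in> carrier ?F" "h n = \<one>"
        using \<open>kernel ?F G h = ?N\<close> by (auto simp: kernel_def)
      then show "x \<in> {s i}" using n s by (simp add: h carrier)
    next
      fix x assume "x \<in> {s i}"
      then have x: "x = h (free_class [(i, True)])" using s by (simp add: h)
      have "free_class [(i, True)] \<in> ?N #>\<^bsub>?F\<^esub> free_class [(i, True)]"
        using N by (intro F.rcos_self normal_imp_subgroup) (auto simp: carrier)
      then show "x \<in> h ` (?N #>\<^bsub>?F\<^esub> free_class [(i, True)])" unfolding x by (rule imageI)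
    qed
    then show ?thesis by simp
  qed
  then show ?thesis unfolding is_presentation_def Let_def by (intro bexI[OF _ iso] allI)
qed

end

text \<open>Concatenation of words becomes multiplication of cosets. A word is thus trivial in the
  quotient exactly when its class lies in \<open>N\<close>.\<close>

lemma word_value_free_group_Mod:
  assumes "N \<lhd> free_group"
  shows "word_value (free_group Mod N) (\<lambda>i. N #>\<^bsub>free_group\<^esub> free_class [(i, True)]) w =
    N #>\<^bsub>free_group\<^esub> free_class w"
proof -
  let ?F = "free_group :: 'a word set monoid"
  let ?Q = "?F Mod N"
  interpret F: group ?F by (rule group_free_group)
  interpret N: normal N ?F by fact
  interpret Q: group ?Q by (rule N.factorgroup_is_group)
  have cl: "free_class w \<in> carrier ?F" for w :: "'a word" by (simp add: free_group_sel)
  have mult: "(N #>\<^bsub>?F\<^esub> free_class w) \<otimes>\<^bsub>?Q\<^esub> (N #>\<^bsub>?F\<^esub> free_class w') =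
      N #>\<^bsub>?F\<^esub> free_class (w @ w')" for w w'
    by (simp add: FactGroup_def N.rcos_sum cl free_group_mult)
  have closed: "N #>\<^bsub>?F\<^esub> free_class w \<in> carrier ?Q" for w
    using cl by (auto simp: FactGroup_def RCOSETS_def)
  have nil: "N #>\<^bsub>?F\<^esub> free_class [] = \<one>\<^bsub>?Q\<^esub>"
    using F.coset_mult_one[OF N.subset] by (simp add: FactGroup_def free_group_sel(2))
  have inv: "inv\<^bsub>?Q\<^esub> (N #>\<^bsub>?F\<^esub> free_class [(i, True)]) = N #>\<^bsub>?F\<^esub> free_class [(i, False)]" for i
  proof (rule Q.inv_equality)
    have "free_class [(i, False), (i, True)] = free_class []"
      using free_eq_cancel[of "[]" i False "[]"] by (simp add: free_class_eq_iff)
    with nil show "(N #>\<^bsub>?F\<^esub> free_class [(i, False)]) \<otimes>\<^bsub>?Q\<^esub>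
        (N #>\<^bsub>?F\<^esub> free_class [(i, True)]) = \<one>\<^bsub>?Q\<^esub>"
      by (simp only: mult append.simps)
  qed (simp_all add: closed)
  show ?thesis
  proof (induction w)
    case (Cons x w)
    then show ?case by (cases x) (simp add: inv mult del: mult_FactGroup one_FactGroup)
  qed (simp add: nil del: one_FactGroup)
qed

text \<open>\<open>Bij X\<close> contains only maps that are \<open>undefined\<close> outside
  \<open>X\<close>, hence the \<open>restrict\<close>.\<close>

lemma BijI_inverse:
  assumes "\<And>x. x \<in> X \<Longrightarrow> f x \<in> X \<and> g x \<in> X \<and> f (g x) = x \<and> g (f x) = x"
  shows "restrict f X \<in> Bij X"
proof -
  have "bij_betw f X X"
    by (rule bij_betw_byWitness[where f' = g]) (use assms in auto)
  then show ?thesis by (simp add: Bij_def)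
qed

lemma BijGroup_mult_apply:
  "f \<in> Bij X \<Longrightarrow> g \<in> Bij X \<Longrightarrow> x \<in> X \<Longrightarrow> (f \<otimes>\<^bsub>BijGroup X\<^esub> g) x = f (g x)"
  by (simp add: BijGroup_def compose_eq)

section \<open>The elements \<open>\<Sigma> n\<close> as Schreier generators\<close>

context neumann
begin

lemma Sigma_eq:
  "\<Sigma> n = tn n 1 \<cdot> mA \<cdot> tn 0 (\<delta> n) \<cdot> tn (- \<iota> n) 1"
proof -
  have "mV [^]\<^bsub>PGL2Z\<^esub> ((1 - \<delta> n) div 2) = tn 0 (\<delta> n)"
    using mC_pow_mV_pow[OF delta_cases, of 0 n] by simp
  then show ?thesis by (simp add: Sigma_gen_def mC_pow)
qed

lemma tn0_mA: "s \<in> {1, -1} \<Longrightarrow> tn 0 s \<cdot> mA = mA \<cdot> tn 0 s"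
  using PGL.va by (auto simp: tn_one mV_tn)

lemma Sigma_closed [simp]: "\<Sigma> n \<in> carrier PGL2Z"
  using delta_cases[of n] by (simp add: Sigma_eq tn_closed)

text \<open>\<open>\<Sigma> n\<close> is the Schreier generator for the transversal
  \<open>That\<close> and the letter \<open>A\<close>, and this lifts \<open>vx_A\<close> from
  cosets to group elements. Both signs share one generator because \<open>A\<close> commutes with
  \<open>tn 0 s\<close>.\<close>

lemma Sigma_tn:
  assumes s: "s \<in> {1, -1}"
  shows "\<Sigma> n \<cdot> tn (\<iota> n) (s * \<delta> n) = tn n s \<cdot> mA"
proof -
  note sgn = delta_cases[of n] sign_mult[OF s, of n]
  have 1: "(1::int) \<in> {1, -1}" by simp
  have "tn 0 (\<delta> n) \<cdot> (tn (- \<iota> n) 1 \<cdot> tn (\<iota> n) (s * \<delta> n)) = tn 0 s"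
    by (simp add: tn_mult[OF 1 sgn(2)] tn_mult[OF sgn] mult.left_commute[of _ s])
  then have "\<Sigma> n \<cdot> tn (\<iota> n) (s * \<delta> n) = tn n 1 \<cdot> (mA \<cdot> tn 0 s)"
    using tn_closed[OF sgn(1)] tn_closed[OF sgn(2)] tn_closed[OF s]
    by (simp add: Sigma_eq PGL.m_assoc tn_closed)
  also have "\<dots> = tn n 1 \<cdot> tn 0 s \<cdot> mA"
    using s by (simp add: tn0_mA[symmetric] PGL.m_assoc tn_closed)
  finally show ?thesis by (simp add: tn_mult[OF 1 s])
qed

text \<open>For \<open>t = tn (\<iota> n) (\<delta> n)\<close> the products
  \<open>\<Sigma> n t\<close> and \<open>t\<close> have the same coset, by \<open>Sigma_tn\<close>
  and \<open>vx_A1\<close>; cancelling \<open>t\<close> shows that \<open>\<Sigma> n\<close> fixes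
  the base coset.\<close>

lemma Sigma_in_S: "\<Sigma> n \<in> S"
proof -
  note t = tn_closed[OF delta_cases[of n]]
  have "vx S (\<iota> n) (\<delta> n) = S \<odot> (\<Sigma> n \<cdot> tn (\<iota> n) (\<delta> n))"
    using Sigma_tn[of 1 n] vx_act[of 1 mA n] by (simp add: vx_A1)
  then have "S \<odot> \<Sigma> n \<odot> tn (\<iota> n) (\<delta> n) = S \<odot> tn (\<iota> n) (\<delta> n)"
    using t by (simp only: vx_def PGL.coset_mult_assoc S_subset Sigma_closed)
  then have "S \<odot> \<Sigma> n \<odot> tn (\<iota> n) (\<delta> n) \<odot> inv\<^bsub>PGL2Z\<^esub> tn (\<iota> n) (\<delta> n) =
      S \<odot> tn (\<iota> n) (\<delta> n) \<odot> inv\<^bsub>PGL2Z\<^esub> tn (\<iota> n) (\<delta> n)" by (rule arg_cong)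
  then have "S \<odot> \<Sigma> n = S"
    using t by (simp add: PGL.coset_mult_assoc S_subset PGL.r_coset_subset_G PGL.m_assoc)
  then show ?thesis by (rule PGL.coset_join1[OF _ Sigma_closed S.subgroup_axioms])
qed

text \<open>\<open>Sigma_tn\<close> is applied along \<open>A\<close> from \<open>n\<close> to
  \<open>\<iota> n\<close> and back, and \<open>A\<^sup>2 = 1\<close>.\<close>

lemma Sigma_inv: "\<Sigma> n \<cdot> \<Sigma> (\<iota> n) = \<one>\<^bsub>PGL2Z\<^esub>"
proof -
  have "\<Sigma> n \<cdot> \<Sigma> (\<iota> n) \<cdot> tn n 1 = \<Sigma> n \<cdot> (tn (\<iota> n) (\<delta> n) \<cdot> mA)"
    using Sigma_tn[OF delta_cases[of n], of "\<iota> n"]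
    by (simp add: iota_iota delta_iota PGL.m_assoc tn_closed)
  also have "\<dots> = tn n 1 \<cdot> mA \<cdot> mA"
    using Sigma_tn[of 1 n] tn_closed[OF delta_cases[of n]] by (simp add: PGL.m_assoc [symmetric])
  also have "\<dots> = tn n 1" by (simp add: PGL.m_assoc PGL.aa tn_closed)
  finally show ?thesis by (simp add: PGL.l_cancel_one' PGL.r_cancel_one tn_closed)
qed

lemma inv_Sigma: "inv\<^bsub>PGL2Z\<^esub> \<Sigma> n = \<Sigma> (\<iota> n)"
  by (rule PGL.inv_equality) (use Sigma_inv[of "\<iota> n"] in \<open>simp_all add: iota_iota\<close>)

lemma Sigma_tn_B:
  assumes s: "s \<in> {1, -1}"
  shows "tn n s \<cdot> mA \<cdot> mC = \<Sigma> n \<cdot> tn (\<iota> n + s * \<delta> n) (s * \<delta> n)"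
proof -
  note t = sign_mult[OF s, of n]
  have "tn (\<iota> n) (s * \<delta> n) \<cdot> mC = tn (\<iota> n + s * \<delta> n) (s * \<delta> n)"
    using tn_mult[OF t, of 1 "\<iota> n" 1] by (simp add: mC_tn)
  then show ?thesis
    using tn_closed[OF t] by (simp add: Sigma_tn[OF s, symmetric] PGL.m_assoc)
qed

text \<open>Applying \<open>B = AC\<close> three times to \<open>tn n 1\<close> runs around the
  orbit with indices \<open>n\<close>, \<open>?m\<close>, \<open>?l\<close> and emits one
  \<open>\<Sigma>\<close> at each; \<open>B\<^sup>3 = 1\<close> makes their product trivial.\<close>

lemma Sigma_triangle:
  "\<Sigma> n \<cdot> \<Sigma> (\<iota> n + \<delta> n) \<cdot> \<Sigma> (\<iota> (n - 1)) = \<one>\<^bsub>PGL2Z\<^esub>"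
proof -
  let ?m = "\<iota> n + \<delta> n" and ?l = "\<iota> (n - 1)"
  let ?t = "tn n 1" and ?d = "\<delta> (n - 1)"
  note d = delta_cases
  \<comment> \<open>By \<open>iota_step\<close> and \<open>delta_step\<close> the third vertex is
    \<open>(?l, ?d)\<close>, and the step out of it returns to \<open>(n, 1)\<close>.\<close>
  have l: "\<iota> ?m + ?d = ?l" by (simp add: iota_step)
  have 1: "?t \<cdot> mA \<cdot> mC = \<Sigma> n \<cdot> tn ?m (\<delta> n)"
    using Sigma_tn_B[of 1 n] by simp
  have 2: "tn ?m (\<delta> n) \<cdot> mA \<cdot> mC = \<Sigma> ?m \<cdot> tn ?l ?d"
    using Sigma_tn_B[OF d, of ?m n] unfolding delta_step l .
  have 3: "tn ?l ?d \<cdot> mA \<cdot> mC = \<Sigma> ?l \<cdot> ?t"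
    using Sigma_tn_B[OF d, of ?l "n - 1"] by (simp add: iota_iota delta_iota)
  have cl: "?t \<in> carrier PGL2Z" "tn ?m (\<delta> n) \<in> carrier PGL2Z" "tn ?l ?d \<in> carrier PGL2Z"
    using d by (simp_all only: tn_closed) (simp add: tn_closed)
  have "?t = ?t \<cdot> mA \<cdot> mC \<cdot> mA \<cdot> mC \<cdot> mA \<cdot> mC"
    using PGL.acacac cl by (simp add: PGL.m_assoc)
  also have "\<dots> = \<Sigma> n \<cdot> (tn ?m (\<delta> n) \<cdot> mA \<cdot> mC) \<cdot> mA \<cdot> mC"
    unfolding 1 using cl by (simp add: PGL.m_assoc)
  also have "\<dots> = \<Sigma> n \<cdot> \<Sigma> ?m \<cdot> (tn ?l ?d \<cdot> mA \<cdot> mC)"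
    unfolding 2 using cl by (simp add: PGL.m_assoc)
  also have "\<dots> = \<Sigma> n \<cdot> \<Sigma> ?m \<cdot> \<Sigma> ?l \<cdot> ?t"
    unfolding 3 using cl by (simp add: PGL.m_assoc)
  finally show ?thesis using cl by (simp add: PGL.r_cancel_one')
qed

text \<open>Schreier rewriting: \<open>A\<close> appends a letter by \<open>Sigma_tn\<close>, while
  \<open>C\<close> and \<open>V\<close> only change the factor \<open>tn n s\<close>. For an element
  of \<open>S\<close> that factor lies in \<open>S\<close> too, so it is trivial.\<close>

lemma word_value_onto:
  assumes "x \<in> S"
  shows "\<exists>u. word_value PGL2Z \<Sigma> u = x"
proof -
  have mem: "word_value PGL2Z \<Sigma> u \<in> S" for u
    by (induction u) (auto simp: word_value_def Sigma_in_S)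
  have "x \<in> generate PGL2Z {mA, mC, mV}"
    using assms S_subset unfolding generate_PGL by blast
  then have "\<exists>u n s. s \<in> {1, -1} \<and> x = word_value PGL2Z \<Sigma> u \<cdot> tn n s"
  proof (induction rule: PGL.generate_induct)
    case one
    show ?case by (rule exI[of _ "[]"], rule exI[of _ 0], rule exI[of _ 1]) (simp add: tn_one)
  next
    case (a x)
    then obtain u n s where x: "s \<in> {1, -1}" "x = word_value PGL2Z \<Sigma> u \<cdot> tn n s" by blast
    note s = sign_mult[OF x(1), of n]
    have "x \<cdot> mA = word_value PGL2Z \<Sigma> (u @ [(n, True)]) \<cdot> tn (\<iota> n) (s * \<delta> n)"
      using tn_closed[OF x(1)] tn_closed[OF s] Sigma_tn[OF x(1)]
      by (simp add: x(2) PGL.word_value_append PGL.m_assoc)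
    with s show ?case by blast
  next
    case (c x)
    then obtain u n s where x: "s \<in> {1, -1}" "x = word_value PGL2Z \<Sigma> u \<cdot> tn n s" by blast
    have "x \<cdot> mC = word_value PGL2Z \<Sigma> u \<cdot> tn (n + s) s"
      using tn_mult[OF x(1), of 1 n 1] tn_closed[OF x(1)]
      by (simp add: x(2) PGL.m_assoc mC_tn tn_closed)
    with x(1) show ?case by blast
  next
    case (v x)
    then obtain u n s where x: "s \<in> {1, -1}" "x = word_value PGL2Z \<Sigma> u \<cdot> tn n s" by blast
    have "x \<cdot> mV = word_value PGL2Z \<Sigma> u \<cdot> tn n (- s)"
      using tn_mult[OF x(1), of "-1" n 0] tn_closed[OF x(1)]
      by (simp add: x(2) PGL.m_assoc mV_tn tn_closed)
    moreover have "- s \<in> {1, -1}" using x(1) by auto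
    ultimately show ?case by blast
  qed
  then obtain u n s where x: "s \<in> {1, -1}" "x = word_value PGL2Z \<Sigma> u \<cdot> tn n s" by blast
  have "inv\<^bsub>PGL2Z\<^esub> word_value PGL2Z \<Sigma> u \<cdot> x \<in> S" using mem assms by blast
  moreover have "inv\<^bsub>PGL2Z\<^esub> word_value PGL2Z \<Sigma> u \<cdot> x = tn n s"
    using tn_closed[OF x(1)] by (simp add: x(2) PGL.m_assoc [symmetric])
  ultimately have "n = 0 \<and> s = 1" using x(1) by (simp add: tn_in_S_iff)
  then have "x = word_value PGL2Z \<Sigma> u" using x(2) by (simp add: tn_one)
  then show ?thesis by blast
qed

text \<open>If \<open>q\<close> satisfies the relations of the presentation in a group \<open>Q\<close>, then PGL(2,Z) acts on
  \<open>Q \<times> \<int> \<times> {1, -1}\<close>, lifting its action on the cosets of \<open>S\<close>. (It acts from the left,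
  through inverses, to match the composition of maps.) The stabilizer \<open>S\<close> of the coset \<open>S\<close> maps
  the fiber over it to itself, and \<open>\<Sigma>\<^sub>n\<close> acts on this fiber as multiplication by \<open>q n\<close>.\<close>

lemma word_value_transfer:
  assumes "group Q" and q [simp]: "\<And>n. q n \<in> carrier Q"
    and q_inv: "\<And>n. q n \<otimes>\<^bsub>Q\<^esub> q (\<iota> n) = \<one>\<^bsub>Q\<^esub>"
    and q_tri: "\<And>n. q n \<otimes>\<^bsub>Q\<^esub> q (\<iota> n + \<delta> n) \<otimes>\<^bsub>Q\<^esub> q (\<iota> (n - 1)) = \<one>\<^bsub>Q\<^esub>"
    and triv: "word_value PGL2Z \<Sigma> u = \<one>\<^bsub>PGL2Z\<^esub>"
  shows "word_value Q q u = \<one>\<^bsub>Q\<^esub>"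
proof -
  interpret Q: group Q by fact
  have inv_q: "inv\<^bsub>Q\<^esub> q n = q (\<iota> n)" for n
    by (rule Q.inv_equality) (use q_inv[of "\<iota> n"] in \<open>simp_all add: iota_iota\<close>)
  \<comment> \<open>A triple \<open>(g, n, s)\<close> stands for \<open>g\<close> times
    \<open>tn n s\<close>, with \<open>q n\<close> in the role of \<open>\<Sigma> n\<close> in
    \<open>Sigma_tn\<close>.\<close>
  define X where "X = carrier Q \<times> (UNIV :: int set) \<times> {1, -1 :: int}"
  define fA where "fA = (\<lambda>(g, n, s) \<in> X. (g \<otimes>\<^bsub>Q\<^esub> q n, \<iota> n, s * \<delta> n))"
  \<comment> \<open>The shift is by \<open>- s\<close> since this is the inverse of right
    multiplication by \<open>C\<close>; \<open>fA\<close> and \<open>fV\<close> are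
    involutions.\<close>
  define fC where "fC = (\<lambda>(g, n, s) \<in> X. (g, n - s, s))"
  define fV where "fV = (\<lambda>(g, n, s) \<in> X. (g, n, - s))"
  have memX [simp]: "(g, n, s) \<in> X \<longleftrightarrow> g \<in> carrier Q \<and> s \<in> {1, -1}" for g n s
    by (simp add: X_def)
  have sgn: "s * \<delta> n = 1 \<or> s * \<delta> n = -1" if "s = 1 \<or> s = -1" for s n
    using sign_mult[of s n] that by simp
  have app: "fA (g, n, s) = (g \<otimes>\<^bsub>Q\<^esub> q n, \<iota> n, s * \<delta> n)" "fC (g, n, s) = (g, n - s, s)"
    "fV (g, n, s) = (g, n, - s)" if "g \<in> carrier Q" "s = 1 \<or> s = -1" for g n s
    using that by (simp_all add: fA_def fC_def fV_def)
  have d: "\<delta> n = 1 \<or> \<delta> n = -1" for n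
    using delta_cases[of n] by simp
  have bij: "fA \<in> Bij X" "fC \<in> Bij X" "fV \<in> Bij X"
  proof -
    show "fA \<in> Bij X" unfolding fA_def
      by (rule BijI_inverse[where g = fA])
        (auto simp: app sgn Q.m_assoc q_inv
          iota_iota delta_iota mult.assoc)
    show "fC \<in> Bij X" unfolding fC_def
      by (rule BijI_inverse[where g = "\<lambda>(g, n, s). (g, n + s, s)"]) auto
    show "fV \<in> Bij X" unfolding fV_def
      by (rule BijI_inverse[where g = "\<lambda>(g, n, s). (g, n, - s)"]) auto
  qed
  interpret B: group "BijGroup X" by (rule group_BijGroup)
  have carrier: "carrier (BijGroup X) = Bij X" by (simp add: BijGroup_def)
  have mult_closed: "f \<otimes>\<^bsub>BijGroup X\<^esub> g \<in> Bij X" if "f \<in> Bij X" "g \<in> Bij X" for f g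
    using that B.m_closed by (simp add: carrier)
  have eq_one: "f = \<one>\<^bsub>BijGroup X\<^esub>"
    if "f \<in> Bij X" "\<And>g n s. g \<in> carrier Q \<Longrightarrow> s = 1 \<or> s = -1 \<Longrightarrow> f (g, n, s) = (g, n, s)" for f
    using that(2) Bij_imp_extensional[OF that(1)]
    by (intro extensionalityI[of _ X]) (auto simp: BijGroup_def X_def)
  \<comment> \<open>\<open>fA\<close> after \<open>fC\<close> lifts the action of
    \<open>B^(-1)\<close> and runs through the orbit backwards. For \<open>s = 1\<close> the
    collected product is the inverse of the triangle relator at \<open>n\<close>, for
    \<open>s = -1\<close> the relator at \<open>n + 1\<close>.\<close>
  have tri: "fA (fC (fA (fC (fA (fC (g, n, s)))))) = (g, n, s)"
    if g: "g \<in> carrier Q" and s: "s = 1 \<or> s = -1" for g n s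
    using s
  proof
    assume [simp]: "s = 1"
    let ?k = "n - 1" and ?m = "\<iota> n + \<delta> n"
    have 1: "fA (fC (g, n, s)) = (g \<otimes>\<^bsub>Q\<^esub> q ?k, \<iota> ?k, \<delta> ?k)"
      using g by (simp add: app)
    have "\<iota> ?k - \<delta> ?k = \<iota> ?m" by (simp only: iota_step)
    moreover have "\<delta> ?k * \<delta> ?m = \<delta> n"
      unfolding delta_step[of n, symmetric] by (simp add: mult.assoc)
    ultimately have 2: "fA (fC (g \<otimes>\<^bsub>Q\<^esub> q ?k, \<iota> ?k, \<delta> ?k)) = (g \<otimes>\<^bsub>Q\<^esub> q ?k \<otimes>\<^bsub>Q\<^esub> q (\<iota> ?m), ?m, \<delta> n)"
      using g d by (simp add: app iota_iota delta_iota)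
    have 3: "fA (fC (g \<otimes>\<^bsub>Q\<^esub> q ?k \<otimes>\<^bsub>Q\<^esub> q (\<iota> ?m), ?m, \<delta> n)) =
        (g \<otimes>\<^bsub>Q\<^esub> q ?k \<otimes>\<^bsub>Q\<^esub> q (\<iota> ?m) \<otimes>\<^bsub>Q\<^esub> q (\<iota> n), n, 1)"
      using g d by (simp add: app iota_iota delta_iota)
    have "q ?k \<otimes>\<^bsub>Q\<^esub> (q (\<iota> ?m) \<otimes>\<^bsub>Q\<^esub> q (\<iota> n)) = inv\<^bsub>Q\<^esub> (q n \<otimes>\<^bsub>Q\<^esub> q ?m \<otimes>\<^bsub>Q\<^esub> q (\<iota> ?k))"
      by (simp add: Q.inv_mult_group inv_q iota_iota)
    then show ?thesis unfolding 1 2 3 q_tri using g by (simp add: Q.m_assoc)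
  next
    assume [simp]: "s = -1"
    let ?k = "n + 1" and ?m = "\<iota> (n + 1) + \<delta> (n + 1)"
    have 1: "fA (fC (g, n, s)) = (g \<otimes>\<^bsub>Q\<^esub> q ?k, \<iota> ?k, - \<delta> ?k)"
      using g by (simp add: app)
    have m: "\<iota> ?m = \<iota> n - \<delta> n" "\<delta> ?k * \<delta> ?m = \<delta> n"
      using iota_step[of ?k] delta_step[of ?k] by simp_all
    have 2: "fA (fC (g \<otimes>\<^bsub>Q\<^esub> q ?k, \<iota> ?k, - \<delta> ?k)) = (g \<otimes>\<^bsub>Q\<^esub> q ?k \<otimes>\<^bsub>Q\<^esub> q ?m, \<iota> ?m, - \<delta> n)"
      using g d[of ?k] m(2) by (subst app) (auto simp: app)
    have 3: "fA (fC (g \<otimes>\<^bsub>Q\<^esub> q ?k \<otimes>\<^bsub>Q\<^esub> q ?m, \<iota> ?m, - \<delta> n)) =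
        (g \<otimes>\<^bsub>Q\<^esub> q ?k \<otimes>\<^bsub>Q\<^esub> q ?m \<otimes>\<^bsub>Q\<^esub> q (\<iota> n), n, -1)"
      using g d[of n] by (subst app) (auto simp: app iota_iota delta_iota m(1))
    show ?thesis unfolding 1 2 3 using g q_tri[of ?k] by (simp add: Q.m_assoc)
  qed
  have modular: "modular_group (BijGroup X) fA fC fV"
  proof (intro modular_group.intro modular_group_axioms.intro B.is_group)
    show "fA \<otimes>\<^bsub>BijGroup X\<^esub> fA = \<one>\<^bsub>BijGroup X\<^esub>"
      by (rule eq_one)
        (simp_all add: bij mult_closed BijGroup_mult_apply app sgn Q.m_assoc q_inv
          iota_iota delta_iota mult.assoc)
    show "fV \<otimes>\<^bsub>BijGroup X\<^esub> fV = \<one>\<^bsub>BijGroup X\<^esub>"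
      by (rule eq_one) (auto simp: bij mult_closed BijGroup_mult_apply app)
    show "(fA \<otimes>\<^bsub>BijGroup X\<^esub> fV) \<otimes>\<^bsub>BijGroup X\<^esub> (fA \<otimes>\<^bsub>BijGroup X\<^esub> fV) = \<one>\<^bsub>BijGroup X\<^esub>"
      by (rule eq_one)
        (use d in \<open>auto simp: minus_equation_iff[of "\<delta> _"] disj_commute bij
          mult_closed BijGroup_mult_apply app Q.m_assoc q_inv iota_iota delta_iota\<close>)
    show "(fC \<otimes>\<^bsub>BijGroup X\<^esub> fV) \<otimes>\<^bsub>BijGroup X\<^esub> (fC \<otimes>\<^bsub>BijGroup X\<^esub> fV) = \<one>\<^bsub>BijGroup X\<^esub>"
      by (rule eq_one) (auto simp: bij mult_closed BijGroup_mult_apply app)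
    show "(fA \<otimes>\<^bsub>BijGroup X\<^esub> fC) \<otimes>\<^bsub>BijGroup X\<^esub> (fA \<otimes>\<^bsub>BijGroup X\<^esub> fC) \<otimes>\<^bsub>BijGroup X\<^esub>
        (fA \<otimes>\<^bsub>BijGroup X\<^esub> fC) = \<one>\<^bsub>BijGroup X\<^esub>"
      by (rule eq_one)
        (simp_all add: bij mult_closed BijGroup_mult_apply tri Bij_imp_funcset[THEN funcset_mem])
  qed (simp_all add: carrier bij)
  then obtain \<rho> where \<rho>: "\<rho> \<in> hom PGL2Z (BijGroup X)" "\<rho> mA = fA" "\<rho> mC = fC" "\<rho> mV = fV"
    by (rule PGL_hom_exists)
  interpret \<rho>: group_hom PGL2Z "BijGroup X" \<rho>
    using \<rho>(1) by (intro group_hom.intro group_hom_axioms.intro group_PGL2Z B.is_group)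
  note \<rho>.hom_mult [simp del] \<rho>.hom_one [simp del]
  have \<rho>_Bij: "\<rho> g \<in> Bij X" if "g \<in> carrier PGL2Z" for g
    using \<rho>.hom_closed[OF that] by (simp add: carrier)
  have \<rho>_mult: "\<rho> (g \<cdot> h) x = \<rho> g (\<rho> h x)"
    if "g \<in> carrier PGL2Z" "h \<in> carrier PGL2Z" "x \<in> X" for g h x
    using that by (simp add: \<rho>.hom_mult BijGroup_mult_apply \<rho>_Bij)
  have \<rho>_one: "\<rho> \<one>\<^bsub>PGL2Z\<^esub> x = x" if "x \<in> X" for x
    using that by (simp add: \<rho>.hom_one) (simp add: BijGroup_def)
  have \<rho>_C: "\<rho> (tn n 1) (g, m, s) = (g, m - n * s, s)"
    if "g \<in> carrier Q" "s = 1 \<or> s = -1" for n g m s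
  proof (induction n arbitrary: m rule: int_induct[where k = 0])
    case base
    show ?case using that by (simp add: tn_one \<rho>_one)
  next
    case (step1 i)
    have "tn (i + 1) 1 = tn i 1 \<cdot> mC" by (simp add: mC_tn tn_mult)
    then show ?case
      using that step1 by (simp add: \<rho>_mult tn_closed \<rho>(3) app algebra_simps)
  next
    case (step2 i)
    have "tn i 1 = tn (i - 1) 1 \<cdot> mC" by (simp add: mC_tn tn_mult)
    then have "\<rho> (tn (i - 1) 1) (g, m, s) = \<rho> (tn i 1) (g, m + s, s)"
      using that by (simp add: \<rho>_mult tn_closed \<rho>(3) app)
    then show ?case using step2 by (simp add: algebra_simps)
  qed
  have \<rho>_V: "\<rho> (tn 0 (\<delta> k)) (g, m, 1) = (g, m, \<delta> k)" if "g \<in> carrier Q" for k g m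
    using delta_cases[of k] that by (auto simp: tn_one \<rho>_one mV_tn [symmetric] \<rho>(4) app)
  \<comment> \<open>The rightmost factor acts first: it moves 0 to \<open>\<iota> k\<close>, then
    the sign becomes \<open>\<delta> k\<close>, \<open>A\<close> leads to \<open>(k, 1)\<close> with
    the factor \<open>q (\<iota> k)\<close>, the inverse of \<open>q k\<close>, and
    \<open>tn k 1\<close> returns to 0.\<close>
  have \<rho>_\<Sigma>: "\<rho> (\<Sigma> k) (g, 0, 1) = (g \<otimes>\<^bsub>Q\<^esub> inv\<^bsub>Q\<^esub> q k, 0, 1)" if "g \<in> carrier Q" for k g
  proof -
    note d = delta_cases[of k]
    have "\<delta> k = 1 \<or> \<delta> k = -1" using d by simp
    then show ?thesis
      using that d
      by (simp add: Sigma_eq \<rho>_mult tn_closed \<rho>_C \<rho>_V \<rho>(2) app iota_iota delta_iota inv_q)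
  qed
  \<comment> \<open>The first letter acts last and multiplies on the right, so the factors collect
    to the inverse of the value in \<open>Q\<close>.\<close>
  have "\<rho> (word_value PGL2Z \<Sigma> u) (g, 0, 1) = (g \<otimes>\<^bsub>Q\<^esub> inv\<^bsub>Q\<^esub> word_value Q q u, 0, 1)"
    if "g \<in> carrier Q" for g u
    using that
  proof (induction u)
    case Nil
    then show ?case by (simp add: \<rho>_one)
  next
    case (Cons x u)
    obtain i b where x: "x = (i, b)" by fastforce
    show ?case
    proof (cases b)
      case True
      then show ?thesis using Cons
        by (simp add: x \<rho>_mult \<rho>_\<Sigma> Q.inv_mult_group Q.m_assoc)
    next
      case False
      then show ?thesis using Cons
        by (simp add: x \<rho>_mult \<rho>_\<Sigma> inv_Sigma inv_q Q.inv_mult_group Q.m_assoc)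
    qed
  qed
  from this[of "\<one>\<^bsub>Q\<^esub>" u] have "inv\<^bsub>Q\<^esub> word_value Q q u = \<one>\<^bsub>Q\<^esub>"
    by (simp add: triv \<rho>_one)
  then show ?thesis by (metis Q.inv_inv Q.inv_one Q.word_value_closed q)
qed

text \<open>For the kernel, \<open>word_value_transfer\<close> is applied with \<open>Q\<close> the
  free group modulo the normal closure of the relators: a word trivial in \<open>S\<close> is
  trivial there, so its class lies in the normal closure.\<close>

lemma presentation:
  "is_presentation (PGL2Z\<lparr>carrier := S\<rparr>) \<Sigma>
       ({[(n, True), (\<iota> n + \<delta> n, True), (\<iota> (n - 1), True)] | n. True} \<union>
        {[(n, True), (\<iota> n, True)] | n. True})"
  (is "is_presentation ?S _ ?R")
proof -
  interpret S: group ?S by (rule PGL.subgroup_imp_group) (rule S.subgroup_axioms)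
  have val: "word_value ?S \<Sigma> u = word_value PGL2Z \<Sigma> u" for u
  proof (induction u)
    case (Cons x u)
    then show ?case
      by (cases x) (simp add: PGL.m_inv_consistent S.subgroup_axioms Sigma_in_S)
  qed simp
  show ?thesis
  proof (rule S.presentationI, unfold val)
    show "\<Sigma> n \<in> carrier ?S" for n by (simp add: Sigma_in_S)
    show "word_value PGL2Z \<Sigma> r = \<one>\<^bsub>?S\<^esub>" if "r \<in> ?R" for r
      using that Sigma_inv Sigma_triangle by (auto simp: PGL.m_assoc)
    show "\<exists>u. word_value PGL2Z \<Sigma> u = x" if "x \<in> carrier ?S" for x
      using that word_value_onto by simp
    fix u :: "int word"
    assume triv: "word_value PGL2Z \<Sigma> u = \<one>\<^bsub>?S\<^esub>"
    let ?F = "free_group :: int word set monoid"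
    define N where "N = normal_closure ?F (free_class ` ?R)"
    let ?q = "\<lambda>n. N #>\<^bsub>?F\<^esub> free_class [(n, True)]"
    interpret F: group ?F by (rule group_free_group)
    have N: "N \<lhd> ?F" unfolding N_def
      by (rule normal_normal_closure) (auto simp: F.is_group free_group_sel)
    then interpret N: normal N ?F .
    let ?Q = "?F Mod N"
    interpret Q: group ?Q by (rule N.factorgroup_is_group)
    have cl: "free_class w \<in> carrier ?F" for w by (simp add: free_group_sel)
    have closed: "?q n \<in> carrier ?Q" for n
      using cl by (auto simp: FactGroup_def RCOSETS_def)
    have one: "\<one>\<^bsub>?Q\<^esub> = N" by (simp add: FactGroup_def)
    note val_N = word_value_free_group_Mod[OF N]
    have rel: "word_value ?Q ?q r = \<one>\<^bsub>?Q\<^esub>" if "r \<in> ?R" for r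
    proof -
      have "free_class r \<in> N" using that unfolding N_def normal_closure_def by blast
      then show ?thesis unfolding one val_N using cl by (intro F.coset_join2 N.subgroup_axioms)
    qed
    have "word_value ?Q ?q u = \<one>\<^bsub>?Q\<^esub>"
    proof (rule word_value_transfer)
      show "?q n \<otimes>\<^bsub>?Q\<^esub> ?q (\<iota> n) = \<one>\<^bsub>?Q\<^esub>" for n
        using rel[of "[(n, True), (\<iota> n, True)]"] closed
        by (simp del: mult_FactGroup one_FactGroup)
      show "?q n \<otimes>\<^bsub>?Q\<^esub> ?q (\<iota> n + \<delta> n) \<otimes>\<^bsub>?Q\<^esub> ?q (\<iota> (n - 1)) = \<one>\<^bsub>?Q\<^esub>" for n
        using rel[of "[(n, True), (\<iota> n + \<delta> n, True), (\<iota> (n - 1), True)]"] closed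
        by (simp add: Q.m_assoc del: mult_FactGroup one_FactGroup)
    qed (use triv in \<open>simp_all add: Q.is_group closed\<close>)
    then have "N #>\<^bsub>?F\<^esub> free_class u = N" by (simp only: val_N one)
    then show "free_class u \<in> normal_closure ?F (free_class ` ?R)"
      using F.coset_join1[OF _ cl N.subgroup_axioms] unfolding N_def by blast
  qed
qed

end

theorem proposition5:
  fixes S :: "(int^2^2) set set"
  assumes "neumann_subgroup S"
  shows
    "(\<forall>n. iota S (iota S n) = n \<and> delta S (iota S n) = delta S n) \<and>
     (\<forall>K k l m \<epsilon>k \<epsilon>l \<epsilon>m.
        B_cycle S K \<and> \<epsilon>k \<in> {0, 1} \<and> \<epsilon>l \<in> {0, 1} \<and> \<epsilon>m \<in> {0, 1} \<and>
        distinct [vertex S k \<epsilon>k, vertex S l \<epsilon>l, vertex S m \<epsilon>m] \<and>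
        {vertex S k \<epsilon>k, vertex S l \<epsilon>l, vertex S m \<epsilon>m} \<subseteq> K \<longrightarrow>
          delta S k * delta S l * delta S m = 1 \<and>
          (\<forall>k' l' m'. mset [k', l', m'] = mset [k, l, m] \<longrightarrow>
             delta S l' * delta S m' - delta S k' = 0)) \<and>
     (\<forall>n. iota S (iota S n + delta S n) = iota S (n - 1) - delta S (n - 1)) \<and>
     is_presentation (PGL2Z\<lparr>carrier := S\<rparr>) (Sigma_gen S)
       ({[(n, True), (iota S n + delta S n, True), (iota S (n - 1), True)] | n. True} \<union>
        {[(n, True), (iota S n, True)] | n. True})"
proof -
  interpret neumann S by unfold_locales (rule assms)
  have cycle: "\<delta> k * \<delta> l * \<delta> m = 1 \<and>
      (\<forall>k' l' m'. mset [k', l', m'] = mset [k, l, m] \<longrightarrow> \<delta> l' * \<delta> m' - \<delta> k' = 0)"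
    if "B_cycle S K" and \<epsilon>: "\<epsilon>k \<in> {0, 1}" "\<epsilon>l \<in> {0, 1}" "\<epsilon>m \<in> {0, 1}"
      and v: "distinct [vertex S k \<epsilon>k, vertex S l \<epsilon>l, vertex S m \<epsilon>m]"
        "{vertex S k \<epsilon>k, vertex S l \<epsilon>l, vertex S m \<epsilon>m} \<subseteq> K"
    for K k l m \<epsilon>k \<epsilon>l \<epsilon>m
  proof
    show prod: "\<delta> k * \<delta> l * \<delta> m = 1"
    proof (rule B_cycle_delta[OF \<open>B_cycle S K\<close>])
      show "distinct [vx S k (1 - 2 * \<epsilon>k), vx S l (1 - 2 * \<epsilon>l), vx S m (1 - 2 * \<epsilon>m)]"
        "{vx S k (1 - 2 * \<epsilon>k), vx S l (1 - 2 * \<epsilon>l), vx S m (1 - 2 * \<epsilon>m)} \<subseteq> K"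
        using v by (simp_all only: vertex_eq_vx \<epsilon>)
    qed (use \<epsilon> in auto)
    show "\<forall>k' l' m'. mset [k', l', m'] = mset [k, l, m] \<longrightarrow> \<delta> l' * \<delta> m' - \<delta> k' = 0"
    proof (intro allI impI)
      fix k' l' m' assume "mset [k', l', m'] = mset [k, l, m]"
      \<comment> \<open>The product of the three signs depends only on the multiset of indices, and
        each sign is its own inverse.\<close>
      then have "prod_mset (image_mset \<delta> (mset [k', l', m'])) =
          prod_mset (image_mset \<delta> (mset [k, l, m]))"
        by simp
      then have "\<delta> k' * (\<delta> l' * \<delta> m') = 1" using prod by (simp add: mult_ac)
      then have "\<delta> k' * (\<delta> k' * (\<delta> l' * \<delta> m')) = \<delta> k'" by simp
      then show "\<delta> l' * \<delta> m' - \<delta> k' = 0" by (simp only: delta_sq)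
    qed
  qed
  show ?thesis
  proof (intro conjI allI impI, goal_cases)
    case (3 K k l m \<epsilon>k \<epsilon>l \<epsilon>m)
    then show ?case by (elim conjE) (rule cycle[THEN conjunct1])
  next
    case (4 K k l m \<epsilon>k \<epsilon>l \<epsilon>m k' l' m')
    then show ?case by (elim conjE) (rule cycle[THEN conjunct2, rule_format])
  qed (fact iota_iota delta_iota iota_step presentation)+
qed

end
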